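(* Let $n\ge 1$ and let $f:\mathbb{D}^n\to\mathbb{D}$ be a holomorphic function which depends on all $n$ variables, i.e. none of the partial derivatives $\frac{\partial f}{\partial z_1},\dots,\frac{\partial f}{\partial z_n}$ is identically zero on $\mathbb{D}^n$. Then $f$ satisfies $$\sum_{i=1}^{n}(1-|z_i|^2)\left|\frac{\partial f}{\partial z_i}(z)\right| = 1-|f(z)|^2$$ for every $z=(z_1,\dots,z_n)\in\mathbb{D}^n$ if and only if there is an $(n+1)\times(n+1)$ complex matrix $U$ which is unitary and symmetric (i.e. $U^*=U^{-1}$ and $U=U^t$), written in block form with respect to $\mathbb{C}^{n+1}=\mathbb{C}\oplus\mathbb{C}^n$ as $$U=\begin{pmatrix} A & B\\ C & D\end{pmatrix}$$ (so $A$ is $1\times 1$, $B$ is $1\times n$, $C$ is $n\times 1$, $D$ is $n\times n$), such that $$f(z)=A+BE_z(I-DE_z)^{-1}C\qquad\text{for all } z\in\mathbb{D}^n,$$ where $E_z$ is the $n\times n$ diagonal matrix with diagonal entries $z_1,z_2,\dots,z_n$. Moreover, such functions $f$ are rational and inner.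
   Context: $\mathbb{D}=\{\zeta\in\mathbb{C}:|\zeta|<1\}$ is the open unit disk and $\mathbb{D}^n=\mathbb{D}\times\cdots\times\mathbb{D}$ is the polydisk. $U^t$ denotes the transpose (without conjugation) and $U^*$ the conjugate transpose. A bounded holomorphic function on $\mathbb{D}^n$ is inner if its radial boundary values have modulus $1$ at almost every point of the torus $\{z\in\mathbb{C}^n: |z_1|=\cdots=|z_n|=1\}$. *)

theory Defs
  imports "HOL-Complex_Analysis.Complex_Analysis"
begin

definition polydisk :: "(complex^'n) set"
  where "polydisk = {z. \<forall>i. cmod (z $ i) < 1}"

text \<open>Complex differentiability: the real Frechet derivative exists and is
  \<open>\<complex>\<close>-linear.\<close>

definition holomorphic_vec_on :: "(complex^'n \<Rightarrow> complex) \<Rightarrow> (complex^'n) set \<Rightarrow> bool"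
    (infixl \<open>(holomorphic'_vec'_on)\<close> 50)
  where "f holomorphic_vec_on S \<longleftrightarrow>
    (\<forall>z\<in>S. \<exists>F. (f has_derivative F) (at z within S) \<and> (\<forall>c v. F (c *s v) = c * F v))"

definition partial_deriv :: "'n \<Rightarrow> (complex^'n \<Rightarrow> complex) \<Rightarrow> complex^'n \<Rightarrow> complex"
  where "partial_deriv i f z = deriv (\<lambda>w. f (\<chi> j. if j = i then w else z $ j)) (z $ i)"

definition conj_transpose :: "complex^'n^'m \<Rightarrow> complex^'m^'n"
  where "conj_transpose M = (\<chi> i j. cnj (M $ j $ i))"

definition unitary_matrix :: "complex^'n^'n \<Rightarrow> bool"
  where "unitary_matrix U \<longleftrightarrow>
    conj_transpose U ** U = mat 1 \<and> U ** conj_transpose U = mat 1"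

definition diag_matrix :: "complex^'n \<Rightarrow> complex^'n^'n"
  where "diag_matrix z = (\<chi> i j. if i = j then z $ i else 0)"

text \<open>The index type \<open>1 + 'n\<close> reflects the splitting of \<open>\<complex>\<^bsup>n+1\<^esup>\<close> as \<open>\<complex> \<oplus> \<complex>\<^bsup>n\<^esup>\<close>.\<close>

definition block_matrix ::
    "complex^1^1 \<Rightarrow> complex^'n^1 \<Rightarrow> complex^1^'n \<Rightarrow> complex^'n^'n \<Rightarrow> complex^(1 + 'n)^(1 + 'n)"
  where "block_matrix A B C D = (\<chi> i j.
    case i of
      Inl a \<Rightarrow> (case j of Inl b \<Rightarrow> A $ a $ b | Inr b \<Rightarrow> B $ a $ b)
    | Inr a \<Rightarrow> (case j of Inl b \<Rightarrow> C $ a $ b | Inr b \<Rightarrow> D $ a $ b))"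

definition complex_polynomial :: "(complex^'n \<Rightarrow> complex) \<Rightarrow> bool"
  where "complex_polynomial p \<longleftrightarrow>
    (\<exists>(S :: ('n \<Rightarrow> nat) set) c. finite S \<and>
       (\<forall>z. p z = (\<Sum>\<alpha>\<in>S. c \<alpha> * (\<Prod>i\<in>UNIV. (z $ i) ^ \<alpha> i))))"

definition rational_on :: "(complex^'n \<Rightarrow> complex) \<Rightarrow> (complex^'n) set \<Rightarrow> bool"
  where "rational_on f S \<longleftrightarrow>
    (\<exists>p q. complex_polynomial p \<and> complex_polynomial q \<and>
       (\<forall>z\<in>S. q z \<noteq> 0 \<and> f z = p z / q z))"

text \<open>Unnormalized Haar measure on the torus, as the image of Lebesgue measure on
  \<open>[0, 2\<pi>]\<^bsup>n\<^esup>\<close>; it is carried by the points all of whose coordinates are unimodular.\<close>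

definition torus_measure :: "(complex^'n) measure"
  where "torus_measure =
    distr (restrict_space lborel (cbox 0 (\<chi> i. 2 * pi))) borel
      (\<lambda>\<theta> :: real^'n. \<chi> i. cis (\<theta> $ i))"

definition inner_function :: "(complex^'n \<Rightarrow> complex) \<Rightarrow> bool"
  where "inner_function f \<longleftrightarrow>
    f holomorphic_vec_on polydisk \<and> bounded (f ` polydisk) \<and>
    (AE \<zeta> in torus_measure. \<exists>L. ((\<lambda>r::real. f (r *\<^sub>R \<zeta>)) \<longlongrightarrow> L) (at_left 1) \<and> cmod L = 1)"

lemma norm_unitary_mult:
  fixes U :: "complex^'m^'m"
  assumes "unitary_matrix U"
  shows "norm (U *v x) = norm x"
proof -
  have sq: "complex_of_real ((norm y)\<^sup>2) = (\<Sum>i\<in>UNIV. cnj (y $ i) * y $ i)" for y :: "complex^'m"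
    by (simp add: norm_vec_def L2_set_def sum_nonneg complex_norm_square mult.commute
        del: of_real_power)
  have adj: "(\<Sum>i\<in>UNIV. cnj ((U *v x) $ i) * y $ i)
      = (\<Sum>i\<in>UNIV. cnj (x $ i) * (conj_transpose U *v y) $ i)" for y
    by (simp add: matrix_vector_mult_def conj_transpose_def sum_distrib_left sum_distrib_right,
        subst sum.swap, simp add: mult_ac)
  have "complex_of_real ((norm (U *v x))\<^sup>2) = complex_of_real ((norm x)\<^sup>2)"
    unfolding sq adj using assms
    by (simp add: matrix_vector_mul_assoc unitary_matrix_def)
  hence "(norm (U *v x))\<^sup>2 = (norm x)\<^sup>2"
    using of_real_eq_iff by blast
  thus ?thesis by simp
qed

text \<open>The inverse in the realization formula is a genuine one.\<close>

lemma invertible_realization: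
  fixes D :: "complex^'n^'n"
  assumes U: "unitary_matrix (block_matrix A B C D)" and z: "z \<in> polydisk"
  shows "invertible (mat 1 - D ** diag_matrix z)"
proof -
  have UNIV_sum: "(\<Sum>i\<in>UNIV. h i) = (\<Sum>i\<in>UNIV. h (Inl i)) + (\<Sum>i\<in>UNIV. h (Inr i))"
    for h :: "1 + 'n \<Rightarrow> 'b::comm_monoid_add"
    by (simp add: UNIV_Plus_UNIV[symmetric] sum.Plus comp_def del: UNIV_Plus_UNIV)
  have D_le: "norm (D *v y) \<le> norm y" for y
  proof -
    define v :: "complex^(1 + 'n)" where "v = (\<chi> i. case i of Inl a \<Rightarrow> 0 | Inr b \<Rightarrow> y $ b)"
    let ?w = "block_matrix A B C D *v v"
    have nv: "norm v = norm y"
      by (simp add: norm_vec_def L2_set_def UNIV_sum v_def)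
    have w: "?w $ Inr i = (D *v y) $ i" for i
      by (simp add: matrix_vector_mult_def block_matrix_def UNIV_sum v_def)
    have "norm (D *v y) \<le> norm ?w"
      unfolding norm_vec_def L2_set_def UNIV_sum w
      by (intro real_sqrt_le_mono) (simp add: sum_nonneg)
    thus ?thesis using norm_unitary_mult[OF U, of v] nv by simp
  qed
  have "x = 0" if "(mat 1 - D ** diag_matrix z) *v x = 0" for x
  proof (rule ccontr)
    assume "x \<noteq> 0"
    then obtain k where k: "x $ k \<noteq> 0" by (auto simp: vec_eq_iff)
    let ?y = "diag_matrix z *v x"
    have y: "?y $ i = z $ i * x $ i" for i
      by (simp add: matrix_vector_mult_def diag_matrix_def if_distrib if_distribR cong: if_cong)
    have zi: "cmod (z $ i) < 1" for i using z by (simp add: polydisk_def)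
    have "norm ?y < norm x"
      unfolding norm_vec_def L2_set_def y
    proof (intro real_sqrt_less_mono sum_strict_mono_ex1 ballI bexI[of _ k])
      show "(norm (z $ i * x $ i))\<^sup>2 \<le> (norm (x $ i))\<^sup>2" for i
        using zi[of i] by (intro power_mono) (auto simp: norm_mult intro: mult_left_le_one_le)
      show "(norm (z $ k * x $ k))\<^sup>2 < (norm (x $ k))\<^sup>2"
        using zi[of k] k by (intro power_strict_mono) (auto simp: norm_mult)
    qed auto
    moreover have "x = D *v ?y"
      using that by (simp add: matrix_vector_mult_diff_rdistrib matrix_vector_mul_assoc)
    ultimately show False using D_le[of ?y] by simp
  qed
  thus ?thesis
    by (simp add: invertible_left_inverse matrix_left_invertible_ker)
qed

end

theory Submission
  imports Defs
begin

text \<open>Near a point where no partial derivative vanishes, put \<open>h\<^sub>i = \<surd>(\<partial>\<^sub>i f)\<close>. The identity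
  becomes \<open>1 - |f|\<^sup>2 = \<Sum> (1 - |z\<^sub>i|\<^sup>2) |h\<^sub>i|\<^sup>2\<close> and polarizes, so that
  \<open>a(z) = (1, E\<^sub>z h(z)) \<mapsto> b(z) = (f(z), h(z))\<close> preserves inner products. A contractive linear
  extension of this map realizes \<open>f\<close>, and comparing the derivative of that realization with
  \<open>\<partial>\<^sub>i f = h\<^sub>i\<^sup>2\<close> yields \<open>f(w) - f(z) = \<Sum> h\<^sub>i(w) (w\<^sub>i - z\<^sub>i) h\<^sub>i(z)\<close>, that is, the bilinear
  product of \<open>a(z)\<close> and \<open>b(w)\<close> is symmetric in \<open>z\<close> and \<open>w\<close>. Under this condition the isometry
  extends to a symmetric unitary matrix. Conversely, for a symmetric unitary realization the same
  difference formula gives \<open>\<partial>\<^sub>i f = h\<^sub>i\<^sup>2\<close>, and unitarity gives the identity. The boundary values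
  are unimodular off the zeros of \<open>det (I - D E\<^sub>z)\<close>, a null set of the torus.\<close>

no_notation fps_nth (infixl \<open>$\<close> 75)

section \<open>Symmetric unitary interpolation\<close>

lemma sum_UNIV_Plus:
  fixes h :: "'a::finite + 'b::finite \<Rightarrow> 'c::comm_monoid_add"
  shows "(\<Sum>i\<in>UNIV. h i) = (\<Sum>i\<in>UNIV. h (Inl i)) + (\<Sum>i\<in>UNIV. h (Inr i))"
  by (simp add: UNIV_Plus_UNIV[symmetric] sum.Plus comp_def del: UNIV_Plus_UNIV)

definition conj_vec :: "complex^'n \<Rightarrow> complex^'n"
  where "conj_vec x = (\<chi> i. cnj (x $ i))"

text \<open>Bilinear, without conjugation: the Hermitian product is
  \<open>cdot x (conj_vec y)\<close>, while symmetry of a matrix is a statement about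
  \<open>cdot\<close> itself.\<close>

definition cdot :: "complex^'n \<Rightarrow> complex^'n \<Rightarrow> complex"
  where "cdot x y = (\<Sum>i\<in>UNIV. x $ i * y $ i)"

lemma conj_vec_simps [simp]:
  "conj_vec x $ i = cnj (x $ i)"
  "conj_vec (x + y) = conj_vec x + conj_vec y"
  "conj_vec (x - y) = conj_vec x - conj_vec y"
  "conj_vec (c *s x) = cnj c *s conj_vec x"
  "conj_vec (r *\<^sub>R x) = r *\<^sub>R conj_vec x"
  "conj_vec (conj_vec x) = x"
  "conj_vec 0 = 0"
  by (simp_all add: conj_vec_def vec_eq_iff)

lemma cdot_simps:
  "cdot (x + y) z = cdot x z + cdot y z"
  "cdot x (y + z) = cdot x y + cdot x z"
  "cdot (x - y) z = cdot x z - cdot y z"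
  "cdot x (y - z) = cdot x y - cdot x z"
  "cdot (c *s x) y = c * cdot x y"
  "cdot x (c *s y) = c * cdot x y"
  "cdot x (- y) = - cdot x y"
  "cdot x 0 = 0" "cdot 0 x = 0"
  by (simp_all add: cdot_def sum.distrib sum_subtractf sum_negf sum_distrib_left algebra_simps)

lemma cdot_commute: "cdot x y = cdot y x"
  by (simp add: cdot_def mult.commute)

lemma cnj_cdot: "cnj (cdot x y) = cdot (conj_vec x) (conj_vec y)"
  by (simp add: cdot_def)

section \<open>Isotropic and Lagrangian real subspaces\<close>

lemma inner_eq_Re_cdot: "x \<bullet> y = Re (cdot x (conj_vec y))" for x :: "complex^'n"
  by (simp add: inner_vec_def cdot_def inner_complex_def)

text \<open>This is the standard symplectic form of the underlying real space. It vanishes on a real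
  subspace iff all Hermitian products there are real.\<close>

lemma inner_imaginary_eq_Im_cdot: "x \<bullet> (\<i> *s y) = Im (cdot x (conj_vec y))" for x :: "complex^'n"
  by (simp add: inner_eq_Re_cdot cdot_simps)

lemma scaleR_eq_of_real_smult: "r *\<^sub>R x = of_real r *s x" for x :: "complex^'n"
  by (simp add: vec_eq_iff complex_eq_iff)

text \<open>Here \<open>span\<close> is the real span. The form is real bilinear, so the condition
  passes from \<open>B\<close> to its span one argument at a time.\<close>

lemma isotropic_span:
  fixes B :: "(complex^'n) set"
  assumes "\<And>x y. x \<in> B \<Longrightarrow> y \<in> B \<Longrightarrow> x \<bullet> (\<i> *s y) = 0"
    and "x \<in> span B" "y \<in> span B"
  shows "x \<bullet> (\<i> *s y) = 0"
proof -
  have s: "subspace {y. x \<bullet> (\<i> *s y) = 0}" for x :: "complex^'n"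
    by (auto simp: subspace_def vec.scale_right_distrib inner_add_right scaleR_eq_of_real_smult
       inner_imaginary_eq_Im_cdot cdot_simps)
  have s': "subspace {x. x \<bullet> (\<i> *s y) = 0}" for y :: "complex^'n"
    by (auto simp: subspace_def inner_add_left)
  have "x \<bullet> (\<i> *s y) = 0" if "x \<in> B" "y \<in> span B" for x y
    using span_induct[OF that(2) s, of x] assms(1) that(1) by auto
  thus ?thesis
    using span_induct[OF assms(2) s', of y] assms(3) by auto
qed

text \<open>A real subspace on which \<open>Im \<langle>x, y\<rangle>\<close> vanishes extends to a maximal one \<open>R\<close> (a Lagrangian
  subspace), and then \<open>\<complex>\<^sup>n = R \<oplus> \<i> R\<close>.\<close>

lemma lagrangian_extension:
  fixes B :: "(complex^'n) set"
  assumes "\<And>x y. x \<in> B \<Longrightarrow> y \<in> B \<Longrightarrow> x \<bullet> (\<i> *s y) = 0"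
  obtains R where "subspace R" "B \<subseteq> R" "\<And>x y. x \<in> R \<Longrightarrow> y \<in> R \<Longrightarrow> x \<bullet> (\<i> *s y) = 0"
    "\<And>x. \<exists>r\<in>R. \<exists>s\<in>R. x = r + \<i> *s s"
proof -
  define P where "P R \<longleftrightarrow> subspace R \<and> B \<subseteq> R \<and> (\<forall>x\<in>R. \<forall>y\<in>R. x \<bullet> (\<i> *s y) = 0)"
    for R :: "(complex^'n) set"
  have "P (span B)"
    unfolding P_def using isotropic_span[OF assms] by (auto simp: span_base)
  \<comment> \<open>The real dimension of the whole space bounds \<open>dim R\<close>, so an
    isotropic subspace of greatest dimension exists.\<close>
  moreover have "\<forall>R. P R \<longrightarrow> dim R < Suc (DIM(complex^'n))"
    using dim_subset_UNIV le_imp_less_Suc by blast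
  ultimately obtain R where R: "P R" and max: "\<And>R'. P R' \<Longrightarrow> dim R' \<le> dim R"
    using ex_has_greatest_nat[of P "span B" dim "Suc (DIM(complex^'n))"] by blast
  \<comment> \<open>By maximality \<open>R\<close> contains everything symplectically orthogonal to
    it: adjoining such a \<open>y\<close> outside \<open>R\<close> would give an isotropic subspace
    of larger dimension.\<close>
  have mem: "y \<in> R" if y: "\<And>x. x \<in> R \<Longrightarrow> y \<bullet> (\<i> *s x) = 0" for y
  proof (rule ccontr)
    assume "y \<notin> R"
    have "x \<bullet> (\<i> *s x') = 0" if "x \<in> insert y R" "x' \<in> insert y R" for x x'
    proof -
      have "x \<bullet> (\<i> *s y) = 0" if "x \<in> R" for x
      proof -
        have "x \<bullet> (\<i> *s y) = - (y \<bullet> (\<i> *s x))"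
          unfolding inner_imaginary_eq_Im_cdot
          by (metis cnj_cdot cdot_commute complex_cnj_cnj cnj.sel(2) conj_vec_simps(6))
        thus ?thesis using y[OF that] by simp
      qed
      moreover have "y \<bullet> (\<i> *s y) = 0"
        by (simp add: inner_vec_def inner_complex_def)
      ultimately show ?thesis
        using that R y by (auto simp: P_def)
    qed
    hence "\<forall>x\<in>span (insert y R). \<forall>x'\<in>span (insert y R). x \<bullet> (\<i> *s x') = 0"
      using isotropic_span by blast
    hence "P (span (insert y R))"
      using R by (auto simp: P_def intro: span_base)
    moreover have "dim (span (insert y R)) = dim R + 1"
      using \<open>y \<notin> R\<close> R by (simp add: dim_insert P_def span_eq_iff[THEN iffD2])
    ultimately show False using max by fastforce
  qed
  have "subspace ((\<lambda>x. \<i> *s x) ` R)"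
    using R by (intro linear_subspace_image)
       (auto simp: P_def linear_iff vec.scale_right_distrib scaleR_eq_of_real_smult)
  hence iR: "span ((\<lambda>x. \<i> *s x) ` R) = (\<lambda>x. \<i> *s x) ` R" by (simp add: span_eq_iff)
  \<comment> \<open>Split \<open>x\<close> orthogonally along the image of \<open>R\<close> under
    multiplication by \<open>\<i>\<close>. The orthogonal component is symplectically orthogonal to
    \<open>R\<close> and hence lies in \<open>R\<close>.\<close>
  have "\<exists>r\<in>R. \<exists>s\<in>R. x = r + \<i> *s s" for x
  proof -
    obtain p q where pq: "p \<in> (\<lambda>x. \<i> *s x) ` R" "\<And>w. w \<in> (\<lambda>x. \<i> *s x) ` R \<Longrightarrow> orthogonal q w"
      "x = p + q"
      using orthogonal_subspace_decomp_exists[of "(\<lambda>x. \<i> *s x) ` R" x] iR by metis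
    have "q \<in> R" using pq(2) by (intro mem) (auto simp: orthogonal_def)
    thus ?thesis using pq(1,3) by (metis add.commute imageE)
  qed
  thus thesis using that R by (auto simp: P_def)
qed

text \<open>A symmetric unitary \<open>U\<close> is determined by the Lagrangian subspace of all
  \<open>x\<close> with \<open>U *v x = conj_vec x\<close>. If \<open>U *v a s = b s\<close>, then
  also \<open>U *v conj_vec (b s) = conj_vec (a s)\<close>, so this subspace contains every
  \<open>c *s a s + conj_vec (c *s b s)\<close>. The two hypotheses make these vectors isotropic;
  they are extended to a Lagrangian subspace, from which \<open>U\<close> is read off.\<close>

lemma symmetric_unitary_interpolation:
  fixes a b :: "'s \<Rightarrow> complex^'n"
  assumes herm: "\<And>s t. s \<in> S \<Longrightarrow> t \<in> S \<Longrightarrow>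
      cdot (a s) (conj_vec (a t)) = cdot (b s) (conj_vec (b t))"
    and sym: "\<And>s t. s \<in> S \<Longrightarrow> t \<in> S \<Longrightarrow> cdot (a s) (b t) = cdot (a t) (b s)"
  obtains U where "unitary_matrix U" "transpose U = U" "\<And>s. s \<in> S \<Longrightarrow> U *v a s = b s"
proof -
  define G where "G = {c *s a s + conj_vec (c *s b s) | c s. s \<in> S}"
  have "x \<bullet> (\<i> *s y) = 0" if xy: "x \<in> G" "y \<in> G" for x y
  proof -
    obtain c s d t where st: "s \<in> S" "t \<in> S"
      and x: "x = c *s a s + conj_vec (c *s b s)" and y: "y = d *s a t + conj_vec (d *s b t)"
      using xy by (auto simp: G_def)
    have 1: "cdot (conj_vec (b s)) (b t) = cnj (cdot (a s) (conj_vec (a t)))"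
      using herm[OF st] by (simp add: cnj_cdot)
    have 2: "cdot (conj_vec (b s)) (conj_vec (a t)) = cnj (cdot (a s) (b t))"
      using sym[OF st] by (simp add: cnj_cdot cdot_commute)
    show ?thesis
      unfolding inner_imaginary_eq_Im_cdot x y
      by (simp add: cdot_simps 1 2 algebra_simps)
  qed
  then obtain R where R: "subspace R" "G \<subseteq> R"
    and iso: "\<And>x y. x \<in> R \<Longrightarrow> y \<in> R \<Longrightarrow> x \<bullet> (\<i> *s y) = 0"
    and dec: "\<And>x. \<exists>r\<in>R. \<exists>s\<in>R. x = r + \<i> *s s"
    using lagrangian_extension[of G] by metis
  obtain E where E: "E \<subseteq> R" "pairwise orthogonal E" "\<And>x. x \<in> E \<Longrightarrow> norm x = 1"
    "independent E" "span E = R"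
    using orthonormal_basis_subspace[OF R(1)] by metis
  have fin: "finite E" using E(4) by (rule independent_imp_finite)
  \<comment> \<open>The sum of \<open>conj_vec e\<close> times its own transpose, over a real
    orthonormal basis of \<open>R\<close>: symmetric by construction, and built to send each
    \<open>e\<close> to \<open>conj_vec e\<close>.\<close>
  define U :: "complex^'n^'n" where "U = (\<chi> i j. \<Sum>e\<in>E. cnj (e $ i) * cnj (e $ j))"
  have Usym: "transpose U = U"
    by (simp add: U_def transpose_def vec_eq_iff mult.commute)
  have Ux: "U *v x = (\<Sum>e\<in>E. cdot x (conj_vec e) *s conj_vec e)" for x
  proof -
    have "(U *v x) $ i = (\<Sum>e\<in>E. cdot x (conj_vec e) *s conj_vec e) $ i" for i
      by (simp add: matrix_vector_mult_def U_def cdot_def sum_distrib_left sum_distrib_right)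
         (subst sum.swap, simp add: mult_ac)
    thus ?thesis by (simp add: vec_eq_iff)
  qed
  \<comment> \<open>Real orthonormal vectors of \<open>R\<close> are Hermitian orthonormal, because
    the imaginary parts vanish by isotropy.\<close>
  have ortho: "cdot e (conj_vec e') = (if e = e' then 1 else 0)" if "e \<in> E" "e' \<in> E" for e e'
  proof -
    have "Im (cdot e (conj_vec e')) = 0"
      using iso[of e e'] that E(1) by (auto simp: inner_imaginary_eq_Im_cdot)
    moreover have "e \<bullet> e' = (if e = e' then 1 else 0)"
      using that E(2,3) by (auto simp: pairwise_def orthogonal_def norm_eq_1)
    ultimately show ?thesis by (auto simp: complex_eq_iff inner_eq_Re_cdot)
  qed
  have "U *v e = conj_vec e" if "e \<in> E" for e
    unfolding Ux using that fin
    by (simp add: ortho if_distrib[of "\<lambda>c. c *s _"] cong: if_cong)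
  moreover have "subspace {x. U *v x = conj_vec x}"
    by (auto simp: subspace_def matrix_vector_right_distrib scaleR_eq_of_real_smult
       matrix_vector_mult_scaleR vector_scalar_commute)
  ultimately have UR: "U *v r = conj_vec r" if "r \<in> R" for r
    using span_induct[of r E "\<lambda>x. U *v x = conj_vec x"] that E(5) by auto
  \<comment> \<open>\<open>U\<close> sends \<open>r + \<i> *s s\<close> to
    \<open>conj_vec r + \<i> *s conj_vec s\<close>. By symmetry the adjoint is \<open>U\<close>
    preceded and followed by conjugation, and it sends this vector back.\<close>
  have "(conj_transpose U ** U) *v x = mat 1 *v x" for x
  proof -
    have c: "conj_transpose U *v y = conj_vec (U *v conj_vec y)" for y
      using Usym[symmetric, THEN arg_cong, of "\<lambda>M. M $ _ $ _"]
      by (simp add: vec_eq_iff conj_transpose_def matrix_vector_mult_def transpose_def)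
    obtain r s where "r \<in> R" "s \<in> R" "x = r + \<i> *s s" using dec by blast
    thus ?thesis
      by (simp add: matrix_vector_mul_assoc[symmetric] c matrix_vector_right_distrib UR
          vector_scalar_commute)
  qed
  hence "conj_transpose U ** U = mat 1" by (simp add: matrix_eq)
  hence un: "unitary_matrix U" by (simp add: unitary_matrix_def matrix_left_right_inverse)
  have "U *v a s = b s" if s: "s \<in> S" for s
  proof -
    \<comment> \<open>The multipliers 1 and \<open>\<i>\<close> give the sum and the difference of
      \<open>U *v a s\<close> and \<open>U *v conj_vec (b s)\<close>, which determines both.\<close>
    have "1 *s a s + conj_vec (1 *s b s) \<in> R" "\<i> *s a s + conj_vec (\<i> *s b s) \<in> R"
      using R(2) s unfolding G_def by blast+
    from this[THEN UR] have 1: "U *v a s + U *v conj_vec (b s) = conj_vec (a s) + b s"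
      and 2: "\<i> *s (U *v a s - U *v conj_vec (b s)) = \<i> *s (b s - conj_vec (a s))"
      by (simp_all add: matrix_vector_right_distrib matrix_vector_mult_diff_distrib
          vector_scalar_commute vector_ssub_ldistrib)
    have "(U *v a s) $ i = b s $ i" for i
    proof -
      have "\<i> * (U *v a s) $ i - \<i> * (U *v conj_vec (b s)) $ i = \<i> * b s $ i - \<i> * cnj (a s $ i)"
        using arg_cong[OF 2, of "\<lambda>x. x $ i"] by simp
      hence "(U *v a s) $ i - (U *v conj_vec (b s)) $ i = b s $ i - cnj (a s $ i)"
        by (metis mult_cancel_left complex_i_not_zero right_diff_distrib)
      moreover have "(U *v a s) $ i + (U *v conj_vec (b s)) $ i = cnj (a s $ i) + b s $ i"
        using arg_cong[OF 1, of "\<lambda>x. x $ i"] by simp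
      ultimately have "2 * (U *v a s) $ i = 2 * b s $ i"
        by (smt (verit, ccfv_SIG) add_diff_eq diff_add_cancel add.commute mult_2)
      thus ?thesis by simp
    qed
    thus ?thesis by (simp add: vec_eq_iff)
  qed
  with un Usym that show thesis by blast
qed

section \<open>Colligations\<close>

definition join_vec :: "complex^'a \<Rightarrow> complex^'b \<Rightarrow> complex^('a::finite + 'b::finite)"
  where "join_vec x y = (\<chi> i. case i of Inl a \<Rightarrow> x $ a | Inr b \<Rightarrow> y $ b)"

lemma join_vec_nth [simp]: "join_vec x y $ Inl i = x $ i" "join_vec x y $ Inr j = y $ j"
  by (simp_all add: join_vec_def)

lemma join_vec_eq_iff [simp]: "join_vec x y = join_vec x' y' \<longleftrightarrow> x = x' \<and> y = y'"
  by (auto simp: vec_eq_iff join_vec_def split_sum_all)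

lemma conj_vec_join_vec [simp]: "conj_vec (join_vec x y) = join_vec (conj_vec x) (conj_vec y)"
  by (auto simp: vec_eq_iff join_vec_def split: sum.split)

lemma cdot_join_vec [simp]: "cdot (join_vec x y) (join_vec x' y') = cdot x x' + cdot y y'"
  by (simp add: cdot_def sum_UNIV_Plus)

lemma norm_join_vec_0 [simp]: "norm (join_vec x 0) = norm x" "norm (join_vec 0 x) = norm x"
  by (simp_all add: norm_vec_def L2_set_def sum_UNIV_Plus)

lemma norm_Inl_le: "norm (\<chi> i. v $ Inl i) \<le> norm v" for v :: "complex^('a::finite + 'b::finite)"
  unfolding norm_vec_def L2_set_def sum_UNIV_Plus
  by (intro real_sqrt_le_mono) (simp add: sum_nonneg)

lemma norm_Inr_le: "norm (\<chi> i. v $ Inr i) \<le> norm v" for v :: "complex^('a::finite + 'b::finite)"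
  unfolding norm_vec_def L2_set_def sum_UNIV_Plus
  by (intro real_sqrt_le_mono) (simp add: sum_nonneg)

text \<open>The map \<open>(a s, 0) \<mapsto> (0, b s)\<close> on the doubled space satisfies the symmetry condition
  trivially, so that a block of the symmetric unitary matrix obtained for it interpolates.\<close>

lemma contractive_interpolation:
  fixes a b :: "'s \<Rightarrow> complex^'n"
  assumes "\<And>s t. s \<in> S \<Longrightarrow> t \<in> S \<Longrightarrow>
      cdot (a s) (conj_vec (a t)) = cdot (b s) (conj_vec (b t))"
  obtains T where "\<And>x. norm (T *v x) \<le> norm x" "\<And>x. norm (transpose T *v x) \<le> norm x"
    "\<And>s. s \<in> S \<Longrightarrow> T *v a s = b s"
proof -
  let ?a = "\<lambda>s. join_vec (a s) (0::complex^'n)" and ?b = "\<lambda>s. join_vec (0::complex^'n) (b s)"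
  have "\<exists>M. unitary_matrix M \<and> transpose M = M \<and> (\<forall>s\<in>S. M *v ?a s = ?b s)"
  proof (rule symmetric_unitary_interpolation[of S ?a ?b])
    show "cdot (?a s) (conj_vec (?a t)) = cdot (?b s) (conj_vec (?b t))" if "s \<in> S" "t \<in> S" for s t
      using assms[OF that] by (simp add: cdot_simps)
    show "cdot (?a s) (?b t) = cdot (?a t) (?b s)" for s t
      by (simp add: cdot_simps)
  qed blast
  then obtain M where M: "unitary_matrix M" "transpose M = M"
    and Ms: "\<And>s. s \<in> S \<Longrightarrow> M *v ?a s = ?b s"
    by blast
  have Msym: "M $ i $ j = M $ j $ i" for i j
    using arg_cong[OF M(2)[symmetric], of "\<lambda>M. M $ i $ j"] by (simp add: transpose_def)
  \<comment> \<open>The block of \<open>M\<close> from the first copy to the second. Symmetry of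
    \<open>M\<close> makes its transpose the block in the other direction, so both are compressions
    of a unitary matrix and hence contractive.\<close>
  define T :: "complex^'n^'n" where "T = (\<chi> i j. M $ Inr i $ Inl j)"
  have T: "T *v x = (\<chi> i. (M *v join_vec x 0) $ Inr i)" for x
    by (simp add: T_def vec_eq_iff matrix_vector_mult_def sum_UNIV_Plus)
  have T': "transpose T *v x = (\<chi> i. (M *v join_vec 0 x) $ Inl i)" for x
    by (simp add: T_def vec_eq_iff matrix_vector_mult_def sum_UNIV_Plus transpose_def Msym)
  show thesis
  proof (rule that)
    show "norm (T *v x) \<le> norm x" for x
      unfolding T using norm_Inr_le norm_unitary_mult[OF M(1)] by (metis norm_join_vec_0(1))
    show "norm (transpose T *v x) \<le> norm x" for x
      unfolding T' using norm_Inl_le norm_unitary_mult[OF M(1)] by (metis norm_join_vec_0(2))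
    show "T *v a s = b s" if "s \<in> S" for s
      unfolding T Ms[OF that] by (simp add: vec_eq_iff)
  qed
qed

lemma diag_matrix_mult_vec [simp]: "(diag_matrix z *v x) $ i = z $ i * x $ i"
  by (simp add: matrix_vector_mult_def diag_matrix_def if_distrib if_distribR cong: if_cong)

text \<open>A nonzero kernel vector would satisfy \<open>x = D *v (diag_matrix z *v x)\<close>, but
  the diagonal factor strictly shrinks its norm and \<open>D\<close> does not increase it. This
  covers a \<open>D\<close> that is a block of a contraction instead of a unitary matrix.\<close>

lemma invertible_contraction:
  fixes D :: "complex^'n^'n"
  assumes D: "\<And>y. norm (D *v y) \<le> norm y" and z: "z \<in> polydisk"
  shows "invertible (mat 1 - D ** diag_matrix z)"
proof -
  have "x = 0" if "(mat 1 - D ** diag_matrix z) *v x = 0" for x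
  proof (rule ccontr)
    assume "x \<noteq> 0"
    then obtain k where k: "x $ k \<noteq> 0" by (auto simp: vec_eq_iff)
    let ?y = "diag_matrix z *v x"
    have zi: "cmod (z $ i) < 1" for i using z by (simp add: polydisk_def)
    have "norm ?y < norm x"
      unfolding norm_vec_def L2_set_def diag_matrix_mult_vec
    proof (intro real_sqrt_less_mono sum_strict_mono_ex1 ballI bexI[of _ k])
      show "(norm (z $ i * x $ i))\<^sup>2 \<le> (norm (x $ i))\<^sup>2" for i
        using zi[of i] by (intro power_mono) (auto simp: norm_mult intro: mult_left_le_one_le)
      show "(norm (z $ k * x $ k))\<^sup>2 < (norm (x $ k))\<^sup>2"
        using zi[of k] k by (intro power_strict_mono) (auto simp: norm_mult)
    qed auto
    moreover have "x = D *v ?y"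
      using that by (simp add: matrix_vector_mult_diff_rdistrib matrix_vector_mul_assoc)
    ultimately show False using D[of ?y] by simp
  qed
  thus ?thesis
    by (simp add: invertible_left_inverse matrix_left_invertible_ker)
qed

section \<open>Block form and the colligation equation\<close>

lemma block_matrix_cases:
  obtains A B C D where "U = block_matrix A B C D"
proof -
  have "U = block_matrix (\<chi> i j. U $ Inl i $ Inl j) (\<chi> i j. U $ Inl i $ Inr j)
     (\<chi> i j. U $ Inr i $ Inl j) (\<chi> i j. U $ Inr i $ Inr j)"
    by (simp add: block_matrix_def vec_eq_iff split: sum.split)
  thus thesis using that by blast
qed

lemma block_matrix_mult_join_vec:
  "block_matrix A B C D *v join_vec x y = join_vec (A *v x + B *v y) (C *v x + D *v y)"
  by (simp add: vec_eq_iff split_sum_all join_vec_def block_matrix_def matrix_vector_mult_def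
      sum_UNIV_Plus split: sum.split)

lemma transpose_block_matrix:
  "transpose (block_matrix A B C D) = block_matrix (transpose A) (transpose C) (transpose B) (transpose D)"
  by (simp add: transpose_def block_matrix_def vec_eq_iff split: sum.split)

lemma block_matrix_eq_iff:
  "block_matrix A B C D = block_matrix A' B' C' D' \<longleftrightarrow> A = A' \<and> B = B' \<and> C = C' \<and> D = D'"
  by (auto simp: block_matrix_def vec_eq_iff split_sum_all)

lemma block_matrix_contraction:
  assumes "\<And>x. norm (block_matrix A B C D *v x) \<le> norm x"
  shows "norm (D *v y) \<le> norm y"
proof -
  have "D *v y = (\<chi> i. (block_matrix A B C D *v join_vec 0 y) $ Inr i)"
    by (simp add: block_matrix_mult_join_vec vec_eq_iff)
  thus ?thesis
    by (metis assms norm_Inr_le norm_join_vec_0(2) order_trans)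
qed

text \<open>The vectors \<open>(1, E\<^sub>z h)\<close> and \<open>(f(z), h)\<close> of the colligation equation
  \<open>U (1, E\<^sub>z h) = (f(z), h)\<close>, whose elimination of \<open>h\<close> is the realization formula.\<close>

definition colligation_in :: "complex^'n \<Rightarrow> complex^'n \<Rightarrow> complex^(1 + 'n)"
  where "colligation_in z h = join_vec (vec 1) (diag_matrix z *v h)"

definition colligation_out :: "complex \<Rightarrow> complex^'n \<Rightarrow> complex^(1 + 'n)"
  where "colligation_out c h = join_vec (vec c) h"

lemma colligation_eq_iff:
  "block_matrix A B C D *v colligation_in z h = colligation_out c h \<longleftrightarrow>
     c = A $ 1 $ 1 + cdot (B $ 1) (diag_matrix z *v h) \<and>
     h = column 1 C + D *v (diag_matrix z *v h)"
proof -
  have 1: "A *v vec 1 + B *v x = vec c \<longleftrightarrow> c = A $ 1 $ 1 + cdot (B $ 1) x" for x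
    by (auto simp: vec_eq_iff matrix_vector_mult_def cdot_def)
  have 2: "C *v vec 1 = column 1 C"
    by (simp add: vec_eq_iff matrix_vector_mult_def column_def)
  show ?thesis
    unfolding colligation_in_def colligation_out_def block_matrix_mult_join_vec join_vec_eq_iff 1 2
    by (simp only: eq_commute)
qed

lemma matrix_inv_mult:
  assumes "invertible M"
  shows "M ** matrix_inv M = mat 1" "matrix_inv M ** M = mat 1"
  using someI_ex[OF assms[unfolded invertible_def]] by (simp_all add: matrix_inv_def)

lemma colligation_state:
  assumes "invertible (mat 1 - D ** diag_matrix z)"
  shows "h = c + D *v (diag_matrix z *v h) \<longleftrightarrow> h = matrix_inv (mat 1 - D ** diag_matrix z) *v c"
proof -
  let ?M = "mat 1 - D ** diag_matrix z"
  have "h = c + D *v (diag_matrix z *v h) \<longleftrightarrow> ?M *v h = c"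
    by (auto simp: matrix_vector_mult_diff_rdistrib matrix_vector_mul_assoc algebra_simps)
  also have "\<dots> \<longleftrightarrow> h = matrix_inv ?M *v c"
    by (metis assms matrix_inv_mult matrix_vector_mul_assoc matrix_vector_mul_lid)
  finally show ?thesis .
qed

lemma colligation_iff_realization:
  fixes D :: "complex^'n^'n"
  assumes "invertible (mat 1 - D ** diag_matrix z)"
  shows "block_matrix A B C D *v colligation_in z h = colligation_out c h \<longleftrightarrow>
    c = (A + B ** diag_matrix z ** matrix_inv (mat 1 - D ** diag_matrix z) ** C) $ 1 $ 1 \<and>
    h = matrix_inv (mat 1 - D ** diag_matrix z) *v column 1 C"
proof -
  have "(B ** diag_matrix z ** N ** C) $ 1 $ 1 = cdot (B $ 1) (diag_matrix z *v (N *v column 1 C))" for N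
  proof -
    have "(P ** C) $ 1 $ 1 = (P *v column 1 C) $ 1" for P :: "complex^'n^1"
      by (simp add: matrix_matrix_mult_def matrix_vector_mult_def column_def)
    moreover have "(B *v x) $ 1 = cdot (B $ 1) x" for x
      by (simp add: matrix_vector_mult_def cdot_def)
    ultimately show ?thesis by (simp add: matrix_vector_mul_assoc[symmetric])
  qed
  thus ?thesis
    unfolding colligation_eq_iff colligation_state[OF assms] by auto
qed

lemma cdot_diag: "cdot (diag_matrix z *v x) y = cdot x (diag_matrix z *v y)"
  by (simp add: cdot_def mult_ac)

lemma cdot_transpose: "cdot (transpose M *v x) y = cdot x (M *v y)"
  by (simp add: cdot_def matrix_vector_mult_def transpose_def sum_distrib_left sum_distrib_right)
     (subst sum.swap, simp add: mult_ac)

text \<open>The vector \<open>g\<close> is the state at \<open>w\<close> of the transposed system.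
  In \<open>d - c = cdot (B $ 1) (diag_matrix w *v k - diag_matrix z *v h)\<close> the row
  \<open>B $ 1\<close> is replaced through the equation for \<open>g\<close>; transposition moves
  \<open>D\<close> to the other factor, which it turns into \<open>k - h\<close>, and the terms with
  \<open>k\<close> cancel.\<close>

lemma colligation_difference:
  assumes z: "block_matrix A B C D *v colligation_in z h = colligation_out c h"
    and w: "block_matrix A B C D *v colligation_in w k = colligation_out d k"
    and g: "g = B $ 1 + transpose D *v (diag_matrix w *v g)"
  shows "d - c = (\<Sum>i\<in>UNIV. g $ i * (w $ i - z $ i) * h $ i)"
proof -
  let ?y = "diag_matrix w *v k - diag_matrix z *v h"
  have "k - h = (column 1 C + D *v (diag_matrix w *v k)) - (column 1 C + D *v (diag_matrix z *v h))"
    using z w unfolding colligation_eq_iff by simp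
  hence kh: "D *v ?y = k - h" by (simp add: matrix_vector_mult_diff_distrib)
  have "d - c = cdot (B $ 1) ?y"
    using z w unfolding colligation_eq_iff by (simp add: cdot_simps)
  also have "B $ 1 = g - transpose D *v (diag_matrix w *v g)"
    using g by (simp add: algebra_simps)
  also have "cdot \<dots> ?y = cdot g ?y - cdot (diag_matrix w *v g) (D *v ?y)"
    unfolding cdot_simps(3) cdot_transpose ..
  also have "\<dots> = cdot g ?y - cdot g (diag_matrix w *v (k - h))"
    unfolding kh cdot_diag ..
  also have "\<dots> = (\<Sum>i\<in>UNIV. g $ i * (w $ i - z $ i) * h $ i)"
    unfolding cdot_def sum_subtractf[symmetric]
    by (rule sum.cong) (simp_all add: algebra_simps)
  finally show ?thesis .
qed

section \<open>Products of colligation vectors\<close>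

lemma cdot_colligation_in:
  "cdot (colligation_in z h) (conj_vec (colligation_in w k)) =
     1 + (\<Sum>i\<in>UNIV. z $ i * cnj (w $ i) * (h $ i * cnj (k $ i)))"
  by (simp add: colligation_in_def) (simp add: cdot_def mult_ac)

lemma cdot_colligation_out:
  "cdot (colligation_out c h) (conj_vec (colligation_out d k)) =
     c * cnj d + (\<Sum>i\<in>UNIV. h $ i * cnj (k $ i))"
  by (simp add: colligation_out_def) (simp add: cdot_def)

lemma cdot_colligation_in_out:
  "cdot (colligation_in z h) (colligation_out d k) = d + (\<Sum>i\<in>UNIV. z $ i * h $ i * k $ i)"
  by (simp add: colligation_in_def colligation_out_def) (simp add: cdot_def)

lemma norm_square_eq_cdot: "complex_of_real ((norm x)\<^sup>2) = cdot x (conj_vec x)"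
  by (simp add: cdot_def norm_vec_def L2_set_def sum_nonneg complex_norm_square del: of_real_power)

text \<open>Both sides of the colligation equation have the same norm, since \<open>U\<close> is
  unitary. The point \<open>z\<close> is arbitrary: on the torus the left-hand side vanishes and
  \<open>cmod c = 1\<close> follows.\<close>

lemma colligation_norm_identity:
  assumes "unitary_matrix U" "U *v colligation_in z h = colligation_out c h"
  shows "(\<Sum>i\<in>UNIV. (1 - (cmod (z $ i))\<^sup>2) * (cmod (h $ i))\<^sup>2) = 1 - (cmod c)\<^sup>2"
proof -
  have "cdot (colligation_in z h) (conj_vec (colligation_in z h)) =
      cdot (colligation_out c h) (conj_vec (colligation_out c h))"
    using norm_unitary_mult[OF assms(1)] assms(2) by (metis norm_square_eq_cdot)
  hence "complex_of_real (\<Sum>i\<in>UNIV. (1 - (cmod (z $ i))\<^sup>2) * (cmod (h $ i))\<^sup>2) =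
      complex_of_real (1 - (cmod c)\<^sup>2)"
    unfolding cdot_colligation_in cdot_colligation_out
    by (simp add: complex_norm_square algebra_simps sum_subtractf del: of_real_power)
  thus ?thesis unfolding of_real_eq_iff .
qed

section \<open>Polynomials and the polydisk\<close>

text \<open>Different indices \<open>k\<close> may carry the same exponent \<open>e k\<close>;
  collecting their coefficients gives the form that the definition asks for. Sums and products then
  need no normalization.\<close>

lemma complex_polynomialI:
  fixes e :: "'k \<Rightarrow> 'n::finite \<Rightarrow> nat"
  assumes "finite K" and p: "\<And>z. p z = (\<Sum>k\<in>K. c k * (\<Prod>i\<in>UNIV. (z $ i) ^ e k i))"
  shows "complex_polynomial p"
proof -
  have "p z = (\<Sum>\<alpha>\<in>e ` K. (\<Sum>k | k \<in> K \<and> e k = \<alpha>. c k) * (\<Prod>i\<in>UNIV. (z $ i) ^ \<alpha> i))" for z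
    unfolding p by (subst sum.image_gen[OF assms(1), of _ e]) (simp add: sum_distrib_right)
  hence "\<forall>z. p z = (\<Sum>\<alpha>\<in>e ` K. (\<Sum>k | k \<in> K \<and> e k = \<alpha>. c k) * (\<Prod>i\<in>UNIV. (z $ i) ^ \<alpha> i))"
    by (rule allI)
  with finite_imageI[OF assms(1), of e] show ?thesis
    unfolding complex_polynomial_def by (intro exI conjI)
qed

lemma complex_polynomialE:
  assumes "complex_polynomial p"
  obtains S c where "finite S" "p = (\<lambda>z. \<Sum>\<alpha>\<in>S. c \<alpha> * (\<Prod>i\<in>UNIV. (z $ i) ^ \<alpha> i))"
  using assms unfolding complex_polynomial_def fun_eq_iff[symmetric]
  by (elim exE conjE) (rule that)

lemma complex_polynomial_const: "complex_polynomial (\<lambda>z. a)"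
  by (rule complex_polynomialI[of "{()}" _ "\<lambda>_. a" "\<lambda>_ _. 0"]) auto

lemma complex_polynomial_nth:
  fixes i :: "'n::finite"
  shows "complex_polynomial (\<lambda>z. z $ i)"
proof (rule complex_polynomialI[of "{()}" _ "\<lambda>_. 1" "\<lambda>_ j. if j = i then 1 else 0"])
  show "z $ i = (\<Sum>k\<in>{()}. 1 * (\<Prod>j\<in>UNIV. z $ j ^ (if j = i then 1 else 0)))" for z :: "complex^'n"
    by (simp add: if_distrib[of "\<lambda>k. _ ^ k"] cong: if_cong)
qed auto

lemma complex_polynomial_add:
  assumes "complex_polynomial p" "complex_polynomial q"
  shows "complex_polynomial (\<lambda>z. p z + q z)"
proof -
  obtain S c where S: "finite S" and p: "p = (\<lambda>z. \<Sum>\<alpha>\<in>S. c \<alpha> * (\<Prod>i\<in>UNIV. (z $ i) ^ \<alpha> i))"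
    using assms(1) by (rule complex_polynomialE)
  obtain T d where T: "finite T" and q: "q = (\<lambda>z. \<Sum>\<alpha>\<in>T. d \<alpha> * (\<Prod>i\<in>UNIV. (z $ i) ^ \<alpha> i))"
    using assms(2) by (rule complex_polynomialE)
  show ?thesis
    unfolding p q using S T
    by (intro complex_polynomialI[of "S <+> T" _ "case_sum c d" "case_sum id id"])
       (auto simp: sum.Plus)
qed

lemma complex_polynomial_mult:
  assumes "complex_polynomial p" "complex_polynomial q"
  shows "complex_polynomial (\<lambda>z. p z * q z)"
proof -
  obtain S c where S: "finite S" and p: "p = (\<lambda>z. \<Sum>\<alpha>\<in>S. c \<alpha> * (\<Prod>i\<in>UNIV. (z $ i) ^ \<alpha> i))"
    using assms(1) by (rule complex_polynomialE)
  obtain T d where T: "finite T" and q: "q = (\<lambda>z. \<Sum>\<alpha>\<in>T. d \<alpha> * (\<Prod>i\<in>UNIV. (z $ i) ^ \<alpha> i))"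
    using assms(2) by (rule complex_polynomialE)
  show ?thesis
    unfolding p q using S T
    by (intro complex_polynomialI[of "S \<times> T" _ "\<lambda>(\<alpha>, \<beta>). c \<alpha> * d \<beta>" "\<lambda>(\<alpha>, \<beta>) i. \<alpha> i + \<beta> i"])
       (auto simp: sum_product sum.cartesian_product power_add prod.distrib algebra_simps
         intro!: sum.cong)
qed

lemma complex_polynomial_sum:
  assumes "\<And>k. k \<in> K \<Longrightarrow> complex_polynomial (p k)"
  shows "complex_polynomial (\<lambda>z. \<Sum>k\<in>K. p k z)"
  using assms
  by (induction K rule: infinite_finite_induct)
     (auto intro: complex_polynomial_const complex_polynomial_add)

lemma complex_polynomial_prod:
  assumes "\<And>k. k \<in> K \<Longrightarrow> complex_polynomial (p k)"
  shows "complex_polynomial (\<lambda>z. \<Prod>k\<in>K. p k z)"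
  using assms
  by (induction K rule: infinite_finite_induct)
     (auto intro: complex_polynomial_const complex_polynomial_mult)

lemma complex_polynomial_det:
  fixes M :: "complex^'n \<Rightarrow> complex^'m^'m"
  assumes "\<And>i j. complex_polynomial (\<lambda>z. M z $ i $ j)"
  shows "complex_polynomial (\<lambda>z. det (M z))"
  unfolding det_def
  by (intro complex_polynomial_sum complex_polynomial_mult complex_polynomial_prod
      complex_polynomial_const assms)

lemma complex_polynomial_line_holomorphic:
  assumes "complex_polynomial p"
  shows "(\<lambda>t. p (x + t *s y)) holomorphic_on S"
proof -
  obtain K c where p: "p = (\<lambda>z. \<Sum>\<alpha>\<in>K. c \<alpha> * (\<Prod>i\<in>UNIV. (z $ i) ^ \<alpha> i))"
    using assms by (rule complex_polynomialE)
  show ?thesis unfolding p by (auto intro!: holomorphic_intros)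
qed

lemma complex_polynomial_continuous:
  assumes "complex_polynomial p"
  shows "continuous_on S p"
proof -
  obtain K c where p: "p = (\<lambda>z. \<Sum>\<alpha>\<in>K. c \<alpha> * (\<Prod>i\<in>UNIV. (z $ i) ^ \<alpha> i))"
    using assms by (rule complex_polynomialE)
  show ?thesis unfolding p by (auto intro!: continuous_intros)
qed

text \<open>Cramer's rule with the common denominator
  \<open>det (mat 1 - D ** diag_matrix z)\<close>. The value \<open>q 0 = 1\<close> is what later
  confines the zeros of \<open>q\<close> on the torus to a null set.\<close>

lemma colligation_state_rational:
  fixes D :: "complex^'n^'n" and c :: "complex^'n"
  obtains q p where "complex_polynomial q" "\<And>k. complex_polynomial (p k)" "q 0 = 1"
    "\<And>z. q z \<noteq> 0 \<longleftrightarrow> invertible (mat 1 - D ** diag_matrix z)"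
    "\<And>z h. q z \<noteq> 0 \<Longrightarrow> h = c + D *v (diag_matrix z *v h) \<longleftrightarrow> h = (\<chi> k. p k z / q z)"
proof -
  define M where "M z = mat 1 - D ** diag_matrix z" for z
  have M: "M z $ i $ j = (if i = j then 1 else 0) + (- D $ i $ j) * z $ j" for z i j
    by (simp add: M_def mat_def matrix_matrix_mult_def diag_matrix_def if_distrib cong: if_cong)
  define q where "q z = det (M z)" for z
  define p where "p k z = det (\<chi> i j. if j = k then c $ i else M z $ i $ j)" for k z
  show thesis
  proof (rule that)
    show "complex_polynomial q"
      unfolding q_def M
      by (intro complex_polynomial_det, unfold M, intro complex_polynomial_add complex_polynomial_mult
           complex_polynomial_const complex_polynomial_nth)
    show "complex_polynomial (p k)" for k
    proof -
      have "complex_polynomial (\<lambda>z. if j = k then c $ i else M z $ i $ j)" for i j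
        unfolding M if_distrib[of complex_polynomial]
        by (cases "j = k") (simp_all only: simp_thms if_True if_False complex_polynomial_add
           complex_polynomial_mult complex_polynomial_const complex_polynomial_nth)
      thus ?thesis unfolding p_def by (intro complex_polynomial_det) simp
    qed
    have "M 0 = mat 1" by (simp add: vec_eq_iff M mat_def)
    thus "q 0 = 1" by (simp add: q_def)
    show "q z \<noteq> 0 \<longleftrightarrow> invertible (mat 1 - D ** diag_matrix z)" for z
      by (simp add: q_def M_def invertible_det_nz)
    show "h = c + D *v (diag_matrix z *v h) \<longleftrightarrow> h = (\<chi> k. p k z / q z)" if "q z \<noteq> 0" for z h
    proof -
      have "h = c + D *v (diag_matrix z *v h) \<longleftrightarrow> M z *v h = c"
        by (auto simp: M_def matrix_vector_mult_diff_rdistrib matrix_vector_mul_assoc algebra_simps)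
      also have "\<dots> \<longleftrightarrow> h = (\<chi> k. p k z / q z)"
        using cramer[of "M z" h c] that by (simp add: q_def p_def)
      finally show ?thesis .
    qed
  qed
qed

lemma polydisk_eq_INT_vimage: "polydisk = (\<Inter>i. (\<lambda>z. z $ i) -` ball 0 1)"
  by (auto simp: polydisk_def)

lemma open_polydisk: "open polydisk"
  unfolding polydisk_eq_INT_vimage
  by (intro open_INT finite ballI open_vimage continuous_intros) auto

lemma convex_polydisk: "convex polydisk"
  unfolding polydisk_eq_INT_vimage
  by (intro convex_INT convex_linear_vimage) (auto simp: linear_iff)

section \<open>Holomorphy along complex lines\<close>

text \<open>Holomorphy restricted to complex lines inherits closure under quotients, square roots
  and locally uniform limits directly from one variable, and on convex sets it still supports the
  identity theorem and polarization.\<close>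

definition line_holomorphic :: "(complex^'n \<Rightarrow> complex) \<Rightarrow> (complex^'n) set \<Rightarrow> bool"
  where "line_holomorphic f S \<longleftrightarrow> (\<forall>x y. (\<lambda>t. f (x + t *s y)) holomorphic_on {t. x + t *s y \<in> S})"

lemma bounded_linear_smult: "bounded_linear (\<lambda>t. t *s y)" for y :: "complex^'n"
  by (auto simp: linear_conv_bounded_linear[symmetric] linear_iff vec.scale_left_distrib
      scaleR_eq_of_real_smult scaleR_conv_of_real)

lemma continuous_on_line: "continuous_on A (\<lambda>t. x + t *s y)" for x y :: "complex^'n"
  by (intro continuous_intros bounded_linear.continuous_on[OF bounded_linear_smult])

lemma open_line:
  fixes x y :: "complex^'n"
  assumes "open S" shows "open {t. x + t *s y \<in> S}"
proof -
  have "open ((\<lambda>t. x + t *s y) -` S)"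
    by (intro open_vimage assms continuous_on_line)
  thus ?thesis by (simp add: vimage_def)
qed

lemma line_convex_combination:
  fixes x y :: "complex^'n"
  assumes "u + v = 1"
  shows "x + (u *\<^sub>R s + v *\<^sub>R t) *s y = u *\<^sub>R (x + s *s y) + v *\<^sub>R (x + t *s y)"
proof -
  have "u *\<^sub>R x + v *\<^sub>R x = x" using assms by (simp add: scaleR_add_left[symmetric])
  moreover have "(u *\<^sub>R s + v *\<^sub>R t) *s y = u *\<^sub>R (s *s y) + v *\<^sub>R (t *s y)"
    by (simp add: vec_eq_iff algebra_simps)
  ultimately show ?thesis by (simp add: algebra_simps)
qed

lemma convex_line:
  fixes x y :: "complex^'n"
  assumes "convex S" shows "convex {t. x + t *s y \<in> S}"
  unfolding convex_def
  by (auto simp: line_convex_combination simp del: vec.scale_left_distrib vector_sadd_rdistrib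
      intro!: convexD[OF assms])

text \<open>On the complex line through \<open>w\<close> and \<open>z\<close>, the convex set
  \<open>S\<close> cuts out a connected open set and \<open>W\<close> a nonempty open subset of it,
  so the identity theorem in one variable applies.\<close>

lemma line_holomorphic_identity:
  fixes f g :: "complex^'n \<Rightarrow> complex"
  assumes "line_holomorphic f S" "line_holomorphic g S" "open S" "convex S"
    and W: "open W" "W \<subseteq> S" "w \<in> W" "\<And>z. z \<in> W \<Longrightarrow> f z = g z" and z: "z \<in> S"
  shows "f z = g z"
proof -
  let ?l = "\<lambda>t. w + t *s (z - w)"
  have l0: "?l 0 = w" and l1: "?l 1 = z" by simp_all
  have "f (?l 1) = g (?l 1)"
  proof (rule analytic_continuation_open[of "{t. ?l t \<in> W}" "{t. ?l t \<in> S}"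
        "\<lambda>t. f (?l t)" "\<lambda>t. g (?l t)"])
    show "{t. ?l t \<in> W} \<noteq> {}" using W(3) l0 by (metis (mono_tags, lifting) mem_Collect_eq empty_iff)
    show "connected {t. ?l t \<in> S}" by (intro convex_connected convex_line assms)
    show "(\<lambda>t. f (?l t)) holomorphic_on {t. ?l t \<in> S}" "(\<lambda>t. g (?l t)) holomorphic_on {t. ?l t \<in> S}"
      using assms(1,2) unfolding line_holomorphic_def by blast+
    show "1 \<in> {t. ?l t \<in> S}" using z by simp
    show "open {t. ?l t \<in> W}" "open {t. ?l t \<in> S}" by (intro open_line W assms)+
  qed (use W in auto)
  thus ?thesis by simp
qed

lemma line_holomorphic_const: "line_holomorphic (\<lambda>_. c) S"
  by (simp add: line_holomorphic_def)

text \<open>Induction on \<open>I\<close>: by the identity theorem the next function cannot vanish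
  on all of the open set found so far, and continuity allows that set to be shrunk.\<close>

lemma common_nonzero_open:
  fixes F :: "'i \<Rightarrow> complex^'n \<Rightarrow> complex"
  assumes S: "open S" "convex S" "S \<noteq> {}" and "finite I"
    and "\<And>i. i \<in> I \<Longrightarrow> line_holomorphic (F i) S" "\<And>i. i \<in> I \<Longrightarrow> continuous_on S (F i)"
    and "\<And>i. i \<in> I \<Longrightarrow> \<exists>z\<in>S. F i z \<noteq> 0"
  shows "\<exists>W. open W \<and> W \<noteq> {} \<and> W \<subseteq> S \<and> (\<forall>i\<in>I. \<forall>z\<in>W. F i z \<noteq> 0)"
  using assms(4-)
proof (induction I rule: finite_induct)
  case empty
  then show ?case using S by (intro exI[of _ S]) auto
next
  case (insert j I)
  have "\<exists>W. open W \<and> W \<noteq> {} \<and> W \<subseteq> S \<and> (\<forall>i\<in>I. \<forall>z\<in>W. F i z \<noteq> 0)"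
    by (rule insert.IH) (use insert.prems in auto)
  then obtain W w where W: "open W" "w \<in> W" "W \<subseteq> S" "\<forall>i\<in>I. \<forall>z\<in>W. F i z \<noteq> 0" by blast
  have cont: "continuous_on W (F j)" using insert.prems(2) W(3) continuous_on_subset by blast
  have "\<exists>z\<in>W. F j z \<noteq> 0"
  proof (rule ccontr)
    assume *: "\<not> ?thesis"
    have "F j z = 0" if "z \<in> S" for z
      using line_holomorphic_identity[OF _ line_holomorphic_const S(1,2) W(1,3,2) _ that, of "F j" 0]
        insert.prems(1) * by auto
    with insert.prems(3) show False by blast
  qed
  moreover have "open (W \<inter> F j -` (- {0}))"
    by (intro continuous_open_preimage cont W) auto
  ultimately show ?case
    using W by (intro exI[of _ "W \<inter> F j -` (- {0})"]) auto
qed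

text \<open>The lines \<open>t \<mapsto> (m + t e, m + t\<^sup>* e)\<close> lie on the diagonal for real \<open>t\<close> and, for suitable
  \<open>m\<close> and \<open>e\<close>, pass through a prescribed point \<open>(z, w)\<close> at \<open>t = \<i>\<close>.\<close>

lemma polarization:
  fixes \<Phi> :: "complex^'n \<Rightarrow> complex^'n \<Rightarrow> complex"
  assumes S: "open S" "convex S"
    and hol: "\<And>m e. (\<lambda>t. \<Phi> (m + t *s e) (m + cnj t *s e)) holomorphic_on
        {t. m + t *s e \<in> S \<and> m + cnj t *s e \<in> S}"
    and diag: "\<And>z. z \<in> S \<Longrightarrow> \<Phi> z z = 0" and zw: "z \<in> S" "w \<in> S"
  shows "\<Phi> z w = 0"
proof -
  define m where "m = (1/2) *s (z + w)"
  define e where "e = (- \<i>/2) *s (z - w)"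
  define T where "T = {t. m + t *s e \<in> S \<and> m + cnj t *s e \<in> S}"
  have Z: "m + \<i> *s e = z" and W: "m + cnj \<i> *s e = w"
    by (simp_all add: m_def e_def vec_eq_iff field_simps)
  have T_eq: "T = {t. m + t *s e \<in> S} \<inter> cnj -` {t. m + t *s e \<in> S}"
    by (auto simp: T_def)
  have T_open: "open T"
    unfolding T_eq by (intro open_Int open_vimage open_line S continuous_intros)
  have T_convex: "convex T"
    unfolding T_eq by (intro convex_Int convex_linear_vimage convex_line S)
      (auto simp: linear_iff)
  have iT: "\<i> \<in> T" using zw Z W by (simp add: T_def)
  have "m \<in> S"
    using convexD[OF S(2) zw, of "1/2" "1/2"]
    by (simp add: m_def vec.scale_right_distrib scaleR_eq_of_real_smult)
  hence "0 \<in> T" by (simp add: T_def)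
  then obtain r where r: "r > 0" "ball 0 r \<subseteq> T" using T_open open_contains_ball by blast
  \<comment> \<open>For real \<open>t\<close> the two arguments of \<open>\<Phi>\<close> agree and
    the function vanishes. Real points of \<open>T\<close> accumulate at 0, which is enough for
    analytic continuation to \<open>\<i>\<close>.\<close>
  have "0 islimpt (T \<inter> range complex_of_real)"
    unfolding islimpt_approachable
  proof (intro allI impI)
    fix d :: real assume "d > 0"
    let ?x = "complex_of_real (min d r / 2)"
    have "?x \<in> T" using r \<open>d > 0\<close> by (intro subsetD[OF r(2)]) (auto simp: min_def simp del: of_real_divide)
    thus "\<exists>x'\<in>T \<inter> range complex_of_real. x' \<noteq> 0 \<and> dist x' 0 < d"
      using r \<open>d > 0\<close> by (intro bexI[of _ ?x]) (auto simp: min_def simp del: of_real_divide)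
  qed
  hence "\<Phi> (m + \<i> *s e) (m + cnj \<i> *s e) = 0"
    using T_open T_convex \<open>0 \<in> T\<close> iT diag
    by (intro analytic_continuation[of "\<lambda>t. \<Phi> (m + t *s e) (m + cnj t *s e)" T "T \<inter> range complex_of_real" 0 \<i>])
       (auto simp: convex_connected T_def intro: hol)
  thus ?thesis unfolding Z W .
qed

text \<open>Conjugations before and after a holomorphic function preserve holomorphy. This handles
  the conjugated factors in the second variable during polarization.\<close>

lemma line_holomorphic_cnj_line:
  assumes "line_holomorphic f S" "open S"
  shows "(\<lambda>t. cnj (f (m + cnj t *s e))) holomorphic_on {t. m + cnj t *s e \<in> S}"
proof -
  have "cnj \<circ> (\<lambda>t. f (m + t *s e)) \<circ> cnj holomorphic_on cnj ` {t. m + t *s e \<in> S}"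
  proof (rule holomorphic_on_compose_cnj_cnj)
    show "open (cnj ` {t. m + t *s e \<in> S})"
      unfolding image_cnj_conv_vimage_cnj
      by (intro open_vimage open_line assms continuous_intros)
  qed (use assms in \<open>auto simp: line_holomorphic_def image_image\<close>)
  thus ?thesis by (simp add: image_cnj_conv_vimage_cnj vimage_def o_def)
qed

lemma holomorphic_vec_on_has_derivative:
  assumes "f holomorphic_vec_on S" "open S" "z \<in> S"
  obtains F where "(f has_derivative F) (at z)" "\<And>c v. F (c *s v) = c * F v"
  using assms at_within_open unfolding holomorphic_vec_on_def by metis

lemma has_field_derivative_line:
  fixes x y :: "complex^'n"
  assumes "(f has_derivative F) (at (x + t *s y))" "\<And>c v. F (c *s v) = c * F v"
  shows "((\<lambda>t. f (x + t *s y)) has_field_derivative F y) (at t)"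
proof -
  have "((\<lambda>t. x + t *s y) has_derivative (\<lambda>h. h *s y)) (at t)"
    by (auto intro!: derivative_eq_intros bounded_linear_imp_has_derivative bounded_linear_smult)
  from has_derivative_compose[OF this assms(1)] show ?thesis
    unfolding has_field_derivative_def assms(2) by (simp only: mult.commute[of _ "F y"])
qed

lemma holomorphic_vec_on_imp_line_holomorphic:
  assumes "f holomorphic_vec_on S" "open S"
  shows "line_holomorphic f S"
  unfolding line_holomorphic_def
proof (intro allI)
  fix x y
  have "\<exists>d. ((\<lambda>t. f (x + t *s y)) has_field_derivative d) (at t)" if "x + t *s y \<in> S" for t
    using holomorphic_vec_on_has_derivative[OF assms that] has_field_derivative_line by metis
  thus "(\<lambda>t. f (x + t *s y)) holomorphic_on {t. x + t *s y \<in> S}"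
    using open_line[OF assms(2)] by (subst holomorphic_on_open) auto
qed

lemma holomorphic_vec_on_imp_continuous_on:
  assumes "f holomorphic_vec_on S" "open S"
  shows "continuous_on S f"
  using holomorphic_vec_on_has_derivative[OF assms] has_derivative_continuous
  by (metis continuous_at_imp_continuous_on)

section \<open>Partial derivatives and their difference quotients\<close>

lemma update_eq_line: "(\<chi> j. if j = i then w else z $ j) = (z - z $ i *s axis i 1) + w *s axis i 1"
  for z :: "complex^'n"
  by (simp add: vec_eq_iff axis_def)

lemma partial_deriv_eq:
  assumes "f holomorphic_vec_on S" "open S" "z \<in> S"
  shows "partial_deriv i f z = deriv (\<lambda>t. f (z + t *s axis i 1)) 0"
proof -
  obtain F where F: "(f has_derivative F) (at z)" "\<And>c v. F (c *s v) = c * F v"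
    using holomorphic_vec_on_has_derivative[OF assms] by blast
  have "partial_deriv i f z = F (axis i 1)"
    unfolding partial_deriv_def update_eq_line
    by (intro DERIV_imp_deriv has_field_derivative_line) (simp_all add: F)
  moreover have "deriv (\<lambda>t. f (z + t *s axis i 1)) 0 = F (axis i 1)"
    by (intro DERIV_imp_deriv has_field_derivative_line) (simp_all add: F)
  ultimately show ?thesis by simp
qed

text \<open>Cauchy's inequality on discs of radius \<open>r/4\<close> about points of
  \<open>ball 0 (r/2)\<close> bounds the second derivative by \<open>2 / (r/4)^2\<close>, which is
  \<open>32 / r^2\<close>; Taylor's formula does the rest. The bound is the same for all such
  \<open>g\<close>.\<close>

lemma difference_quotient_bound:
  assumes g: "g holomorphic_on ball 0 r" "\<And>t. t \<in> ball 0 r \<Longrightarrow> cmod (g t) \<le> 1"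
    and r: "r > 0" and e: "e \<noteq> 0" "cmod e < r / 2"
  shows "cmod ((g e - g 0) / e - deriv g 0) \<le> 32 / r\<^sup>2 * cmod e"
proof -
  have B: "cmod ((deriv ^^ Suc 1) g x) \<le> 32 / r\<^sup>2" if "x \<in> ball 0 (r/2)" for x
  proof -
    have sub: "cball x (r/4) \<subseteq> ball 0 r"
    proof
      fix t assume "t \<in> cball x (r/4)"
      thus "t \<in> ball 0 r" using that r norm_triangle_ineq2[of t x] by (auto simp: dist_norm norm_minus_commute)
    qed
    have "cmod ((deriv ^^ 2) g x) \<le> fact 2 * 1 / (r/4)^2"
    proof (rule Cauchy_inequality)
      show "g holomorphic_on ball x (r/4)"
        using g(1) sub ball_subset_cball holomorphic_on_subset by blast
      show "continuous_on (cball x (r/4)) g"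
        using g(1) sub holomorphic_on_imp_continuous_on holomorphic_on_subset by blast
      show "cmod (g t) \<le> 1" if "cmod (x - t) = r/4" for t
        using that sub by (intro g(2)) (auto simp: dist_norm)
    qed (use r in auto)
    thus ?thesis by (simp add: power_divide numeral_2_eq_2)
  qed
  have "cmod ((deriv ^^ 0) g e - (\<Sum>i\<le>1. (deriv ^^ i) g 0 * (e - 0) ^ i / fact i))
      \<le> 32 / r\<^sup>2 * cmod (e - 0) ^ Suc 1 / fact 1"
  proof (rule complex_Taylor[of "ball 0 (r/2)" 1 "\<lambda>i. (deriv ^^ i) g"])
    show "((deriv ^^ i) g has_field_derivative (deriv ^^ Suc i) g x) (at x within ball 0 (r/2))"
      if "x \<in> ball 0 (r/2)" for i x
    proof -
      have "((deriv ^^ i) g has_field_derivative (deriv ^^ Suc i) g x) (at x)"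
        using that r by (intro has_field_derivative_higher_deriv[OF g(1)]) auto
      thus ?thesis by (rule has_field_derivative_at_within)
    qed
  qed (use B e r in auto)
  hence "cmod (g e - g 0 - deriv g 0 * e) \<le> 32 / r\<^sup>2 * cmod e * cmod e"
    by (simp add: power2_eq_square algebra_simps)
  moreover have "(g e - g 0) / e - deriv g 0 = (g e - g 0 - deriv g 0 * e) / e"
    using e by (simp add: field_simps)
  ultimately show ?thesis
    using e by (simp add: norm_divide divide_le_eq)
qed

text \<open>Leaves room for coordinate steps of length up to \<open>d\<close>; these sets exhaust
  the polydisk as \<open>d\<close> tends to 0.\<close>

definition polydisk_shrink :: "real \<Rightarrow> (complex^'n) set"
  where "polydisk_shrink d = {z. \<forall>i. cmod (z $ i) < 1 - d}"

lemma polydisk_shrink_eq_INT_vimage: "polydisk_shrink d = (\<Inter>i. (\<lambda>z. z $ i) -` ball 0 (1 - d))"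
  by (auto simp: polydisk_shrink_def)

lemma open_polydisk_shrink: "open (polydisk_shrink d)"
  unfolding polydisk_shrink_eq_INT_vimage
  by (intro open_INT finite ballI open_vimage continuous_intros) auto

lemma polydisk_eq_UN_shrink: "polydisk = (\<Union>d\<in>{0<..}. polydisk_shrink d)"
proof (intro equalityI subsetI)
  fix z :: "complex^'n" assume z: "z \<in> polydisk"
  define d where "d = Min (range (\<lambda>i. 1 - cmod (z $ i))) / 2"
  have pos: "Min (range (\<lambda>i. 1 - cmod (z $ i))) > 0"
    using z by (subst Min_gr_iff) (auto simp: polydisk_def)
  have "Min (range (\<lambda>i. 1 - cmod (z $ i))) \<le> 1 - cmod (z $ i)" for i by (intro Min_le) auto
  hence "d > 0" "z \<in> polydisk_shrink d"
    using pos unfolding d_def polydisk_shrink_def mem_Collect_eq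
    by (simp, intro allI) (smt (verit) field_sum_of_halves)
  thus "z \<in> (\<Union>d\<in>{0<..}. polydisk_shrink d)" by auto
next
  fix z :: "complex^'n" assume "z \<in> (\<Union>d\<in>{0<..}. polydisk_shrink d)"
  thus "z \<in> polydisk" unfolding polydisk_def polydisk_shrink_def by clarsimp (smt (verit))
qed

lemma polydisk_shrink_perturb:
  assumes "z \<in> polydisk_shrink d" "cmod t \<le> d"
  shows "z + t *s axis i 1 \<in> polydisk"
proof -
  have "cmod ((z + t *s axis i 1) $ j) < 1" for j
  proof -
    have "cmod (t * axis i 1 $ j) \<le> cmod t" by (simp add: axis_def)
    moreover have "cmod (z $ j) < 1 - d" using assms(1) by (simp add: polydisk_shrink_def)
    ultimately show ?thesis
      using assms(2) norm_triangle_ineq[of "z $ j" "t * axis i 1 $ j"] by simp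
  qed
  thus ?thesis by (simp add: polydisk_def)
qed

context
  fixes f :: "complex^'n \<Rightarrow> complex" and i :: 'n
  assumes hol: "f holomorphic_vec_on polydisk" and bd: "f ` polydisk \<subseteq> ball 0 1"
begin

text \<open>Each point of the shrunken polydisk is the centre of a disc of radius \<open>d\<close>
  in the direction of coordinate \<open>i\<close> on which \<open>f\<close> is bounded by 1, so the
  error of the difference quotient is bounded independently of the point.\<close>

lemma partial_deriv_uniform_limit:
  assumes d: "d > 0"
  shows "uniform_limit (polydisk_shrink d)
    (\<lambda>n z. (f (z + of_real (d / (3 + real n)) *s axis i 1) - f z) / of_real (d / (3 + real n)))
    (partial_deriv i f) sequentially"
proof (rule uniform_limitI)
  fix r :: real assume r: "r > 0"
  have "(\<lambda>n. 32 / d\<^sup>2 * (d / (3 + real n))) \<longlonglongrightarrow> 0" 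
    by (intro tendsto_mult_right_zero tendsto_divide_0[OF tendsto_const] filterlim_at_top_imp_at_infinity
        filterlim_tendsto_add_at_top[OF tendsto_const] filterlim_real_sequentially)
  hence "\<forall>\<^sub>F n in sequentially. 32 / d\<^sup>2 * (d / (3 + real n)) < r"
    using r by (rule order_tendstoD)
  thus "\<forall>\<^sub>F n in sequentially. \<forall>z\<in>polydisk_shrink d.
      dist ((f (z + of_real (d / (3 + real n)) *s axis i 1) - f z) / of_real (d / (3 + real n)))
        (partial_deriv i f z) < r"
  proof eventually_elim
    case (elim n)
    \<comment> \<open>The summand 3 keeps the step below \<open>d / 2\<close>, as the error bound
      requires, already for \<open>n = 0\<close>.\<close>
    define e where "e = complex_of_real (d / (3 + real n))"
    have ne: "cmod e = d / (3 + real n)" using d by (simp add: e_def del: of_real_divide)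
    have e: "e \<noteq> 0" "cmod e < d / 2"
      using d ne by (auto simp: pos_divide_less_eq)
    show ?case unfolding e_def[symmetric]
    proof
      fix z :: "complex^'n" assume z: "z \<in> polydisk_shrink d"
      hence zp: "z \<in> polydisk" using d unfolding polydisk_eq_UN_shrink by auto
      let ?g = "\<lambda>t. f (z + t *s axis i 1)"
      have "?g holomorphic_on {t. z + t *s axis i 1 \<in> polydisk}"
        using holomorphic_vec_on_imp_line_holomorphic[OF hol open_polydisk]
        by (simp add: line_holomorphic_def)
      hence "?g holomorphic_on ball 0 d"
        by (rule holomorphic_on_subset) (auto intro: polydisk_shrink_perturb[OF z])
      moreover have "cmod (?g t) \<le> 1" if "t \<in> ball 0 d" for t
      proof -
        have "z + t *s axis i 1 \<in> polydisk"
          using that by (auto intro: polydisk_shrink_perturb[OF z])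
        hence "?g t \<in> ball 0 1" using bd by blast
        thus ?thesis by simp
      qed
      ultimately have "cmod ((?g e - ?g 0) / e - deriv ?g 0) \<le> 32 / d\<^sup>2 * cmod e"
        by (rule difference_quotient_bound) (use d e in auto)
      thus "dist ((f (z + e *s axis i 1) - f z) / e) (partial_deriv i f z) < r"
        using elim by (simp add: partial_deriv_eq[OF hol open_polydisk zp] dist_norm ne)
    qed
  qed
qed

lemma partial_deriv_continuous_on: "continuous_on polydisk (partial_deriv i f)"
  unfolding polydisk_eq_UN_shrink
proof (rule continuous_on_open_UN)
  fix d :: real assume "d \<in> {0<..}"
  hence d: "d > 0" by simp
  note cf = holomorphic_vec_on_imp_continuous_on[OF hol open_polydisk]
  have sub: "polydisk_shrink d \<subseteq> polydisk" using d unfolding polydisk_eq_UN_shrink by auto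
  show "continuous_on (polydisk_shrink d) (partial_deriv i f)"
  proof (rule uniform_limit_theorem[OF always_eventually partial_deriv_uniform_limit[OF d]], rule allI)
    fix n
    have "d / (3 + real n) \<le> d" using d by (simp add: divide_le_eq)
    thus "continuous_on (polydisk_shrink d)
       (\<lambda>z. (f (z + of_real (d / (3 + real n)) *s axis i 1) - f z) / of_real (d / (3 + real n)))"
      using d sub
      by (intro continuous_intros continuous_on_compose2[OF cf])
         (auto intro!: polydisk_shrink_perturb simp del: of_real_divide of_real_add)
  qed simp
qed (rule open_polydisk_shrink)

text \<open>Weierstrass' theorem along each line: on the part inside a shrunken polydisk the
  difference quotients are holomorphic and converge uniformly, and these parts cover the line's
  intersection with the polydisk.\<close>

lemma partial_deriv_line_holomorphic: "line_holomorphic (partial_deriv i f) polydisk"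
  unfolding line_holomorphic_def
proof (intro allI)
  fix x y :: "complex^'n"
  have "(\<lambda>t. partial_deriv i f (x + t *s y)) holomorphic_on (\<Union>d\<in>{0<..}. {t. x + t *s y \<in> polydisk_shrink d})"
  proof (rule holomorphic_on_UN_open)
    fix d :: real assume "d \<in> {0<..}"
    hence d: "d > 0" by simp
    let ?S = "{t. x + t *s y \<in> polydisk_shrink d}"
    have sub: "polydisk_shrink d \<subseteq> polydisk" using d unfolding polydisk_eq_UN_shrink by auto
    have hf: "(\<lambda>t. f (u + t *s y)) holomorphic_on {t. u + t *s y \<in> polydisk}" for u
      using holomorphic_vec_on_imp_line_holomorphic[OF hol open_polydisk]
      by (simp add: line_holomorphic_def)
    show opn: "open ?S" by (intro open_line open_polydisk_shrink)
    show "(\<lambda>t. partial_deriv i f (x + t *s y)) holomorphic_on ?S"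
    proof (rule holomorphic_uniform_sequence[OF opn])
      fix n
      define e where "e = complex_of_real (d / (3 + real n))"
      have ne: "cmod e \<le> d" using d by (simp add: e_def divide_le_eq del: of_real_divide)
      have e: "e \<noteq> 0" using d by (simp add: e_def del: of_real_divide)
      have "(\<lambda>t. f ((x + e *s axis i 1) + t *s y)) holomorphic_on ?S"
      proof (rule holomorphic_on_subset[OF hf])
        show "?S \<subseteq> {t. x + e *s axis i 1 + t *s y \<in> polydisk}"
        proof
          fix t assume "t \<in> ?S"
          hence "(x + t *s y) + e *s axis i 1 \<in> polydisk" using polydisk_shrink_perturb[OF _ ne] by blast
          thus "t \<in> {t. x + e *s axis i 1 + t *s y \<in> polydisk}" by (simp add: add_ac)
        qed
      qed
      moreover have "(\<lambda>t. f (x + t *s y)) holomorphic_on ?S"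
        by (rule holomorphic_on_subset[OF hf]) (use sub in auto)
      ultimately have "(\<lambda>t. (f ((x + e *s axis i 1) + t *s y) - f (x + t *s y)) / e) holomorphic_on ?S"
        using e by (intro holomorphic_intros)
      thus "(\<lambda>t. (f (x + t *s y + of_real (d / (3 + real n)) *s axis i 1) - f (x + t *s y)) /
          of_real (d / (3 + real n))) holomorphic_on ?S"
        unfolding e_def[symmetric] by (simp add: add_ac)
    next
      fix t assume "t \<in> ?S"
      then obtain r where r: "r > 0" "cball t r \<subseteq> ?S" using opn open_contains_cball by metis
      have "uniform_limit ?S
        (\<lambda>n t. (f (x + t *s y + of_real (d / (3 + real n)) *s axis i 1) - f (x + t *s y)) /
          of_real (d / (3 + real n))) (\<lambda>t. partial_deriv i f (x + t *s y)) sequentially"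
        by (rule uniform_limit_compose'[OF partial_deriv_uniform_limit[OF d]]) auto
      with r show "\<exists>r>0. cball t r \<subseteq> ?S \<and> uniform_limit (cball t r)
        (\<lambda>n t. (f (x + t *s y + of_real (d / (3 + real n)) *s axis i 1) - f (x + t *s y)) /
          of_real (d / (3 + real n))) (\<lambda>t. partial_deriv i f (x + t *s y)) sequentially"
        using uniform_limit_on_subset by blast
    qed
  qed
  thus "(\<lambda>t. partial_deriv i f (x + t *s y)) holomorphic_on {t. x + t *s y \<in> polydisk}"
    unfolding polydisk_eq_UN_shrink by (simp add: Collect_bex_eq)
qed

end

section \<open>Zero sets on the torus\<close>

lemma cis_vec_shift: "(\<chi> i. cis ((\<theta> + t *\<^sub>R (\<chi> i. 1)) $ i)) = cis t *s (\<chi> i. cis (\<theta> $ i))"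
  for \<theta> :: "real^'n"
  by (simp add: vec_eq_iff cis_mult add.commute)

lemma continuous_on_cis_vec: "continuous_on S (\<lambda>\<theta> :: real^'n. \<chi> i. cis (\<theta> $ i))"
  by (intro continuous_intros)

text \<open>The entire function \<open>c \<mapsto> q (c *s y)\<close> is nonzero at 0, so it has
  countably many zeros. They are pulled back along \<open>cis\<close>, which is injective on
  \<open>{0..1}\<close> because \<open>sin\<close> is.\<close>

lemma countable_torus_line_zeros:
  fixes \<theta> :: "real^'n"
  assumes q: "complex_polynomial q" "q 0 \<noteq> 0"
  shows "countable {t \<in> {0..1::real}. q (\<chi> i. cis ((\<theta> + t *\<^sub>R (\<chi> i. 1)) $ i)) = 0}" (is "countable ?T")
proof -
  define y :: "complex^'n" where "y = (\<chi> i. cis (\<theta> $ i))"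
  have "countable {c. q (0 + c *s y) = 0}"
  proof (rule ccontr)
    assume "uncountable {c. q (0 + c *s y) = 0}"
    hence "(\<lambda>c. q (0 + c *s y)) = (\<lambda>_. 0)"
      by (intro holomorphic_countable_equal_UNIV complex_polynomial_line_holomorphic[OF q(1)]) auto
    from fun_cong[OF this, of 0] q(2) show False by simp
  qed
  moreover have "cis ` ?T \<subseteq> {c. q (0 + c *s y) = 0}"
    unfolding cis_vec_shift y_def by auto
  ultimately have "countable (cis ` ?T)" using countable_subset by blast
  moreover have "inj_on cis ?T"
  proof (rule inj_onI)
    fix s t assume st: "s \<in> ?T" "t \<in> ?T" "cis s = cis t"
    hence "sin s = sin t" by (simp add: complex_eq_iff)
    moreover have "- (pi/2) \<le> s" "s \<le> pi/2" "- (pi/2) \<le> t" "t \<le> pi/2"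
      using st(1,2) pi_gt3 by auto
    ultimately show "s = t" by (metis sin_inj_pi)
  qed
  ultimately show ?thesis by (rule countable_image_inj_on)
qed

text \<open>The polynomial \<open>t \<mapsto> q(t \<zeta>)\<close> is nonzero at \<open>0\<close>, so that every line of direction
  \<open>(1, \<dots>, 1)\<close> meets the zero set of \<open>q(cis \<theta>)\<close> in a countable set; Tonelli does the rest.\<close>

lemma AE_polynomial_torus_nonzero:
  fixes q :: "complex^'n \<Rightarrow> complex"
  assumes q: "complex_polynomial q" "q 0 \<noteq> 0"
  shows "AE \<theta> in lborel. q (\<chi> i. cis (\<theta> $ i)) \<noteq> 0"
proof -
  define N where "N = {\<theta> :: real^'n. q (\<chi> i. cis (\<theta> $ i)) = 0}"
  let ?e = "(\<chi> i. 1) :: real^'n"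
  have "closed N"
    unfolding N_def
    by (intro closed_Collect_eq continuous_on_compose2[OF complex_polynomial_continuous[OF q(1), of UNIV]
        continuous_on_cis_vec] continuous_intros) auto
  hence N[measurable]: "N \<in> sets borel" by (rule borel_closed)
  \<comment> \<open>Integrating first over \<open>\<theta>\<close> gives the measure of
    \<open>N\<close> for each \<open>t\<close> in \<open>{0..1}\<close>, by translation invariance;
    integrating first over \<open>t\<close> gives 0, by countability.\<close>
  define G :: "real \<Rightarrow> real^'n \<Rightarrow> ennreal"
    where "G t \<theta> = indicator N (\<theta> + t *\<^sub>R ?e) * indicator {0..1} t" for t \<theta>
  have meas: "case_prod G \<in> borel_measurable (lborel \<Otimes>\<^sub>M lborel)"
    unfolding G_def by measurable
  have 1: "(\<integral>\<^sup>+\<theta>. G t \<theta> \<partial>lborel) = emeasure lborel N * indicator {0..1} t" for t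
  proof -
    have "(\<integral>\<^sup>+\<theta>. G t \<theta> \<partial>lborel) = (\<integral>\<^sup>+\<theta>. indicator N (t *\<^sub>R ?e + \<theta>) \<partial>lborel) * indicator {0..1} t"
      unfolding G_def by (subst nn_integral_multc) (auto simp: add.commute)
    also have "(\<integral>\<^sup>+\<theta>. indicator N (t *\<^sub>R ?e + \<theta>) \<partial>lborel) =
        (\<integral>\<^sup>+\<theta>. indicator N \<theta> \<partial>distr lborel borel ((+) (t *\<^sub>R ?e)))"
      by (subst nn_integral_distr) auto
    also have "\<dots> = emeasure lborel N" by (simp add: lborel_distr_plus)
    finally show ?thesis .
  qed
  have 2: "(\<integral>\<^sup>+t. G t \<theta> \<partial>lborel) = 0" for \<theta>
  proof -
    let ?T = "{t \<in> {0..1::real}. q (\<chi> i. cis ((\<theta> + t *\<^sub>R ?e) $ i)) = 0}"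
    have T: "?T \<in> null_sets lborel"
      by (intro countable_imp_null_set_lborel countable_torus_line_zeros q)
    have "G t \<theta> = indicator ?T t" for t
      by (auto simp: G_def N_def indicator_def)
    thus ?thesis using T by (simp add: null_sets_def)
  qed
  have "emeasure lborel N = (\<integral>\<^sup>+t. emeasure lborel N * indicator {0..1::real} t \<partial>lborel)"
    by (subst nn_integral_cmult) auto
  also have "\<dots> = (\<integral>\<^sup>+t. \<integral>\<^sup>+\<theta>. G t \<theta> \<partial>lborel \<partial>lborel)" by (simp add: 1)
  also have "\<dots> = (\<integral>\<^sup>+\<theta>. \<integral>\<^sup>+t. G t \<theta> \<partial>lborel \<partial>lborel)"
    by (rule lborel_pair.Fubini'[OF meas, symmetric])
  also have "\<dots> = 0" by (simp add: 2)
  finally have "N \<in> null_sets lborel" by (simp add: null_sets_def)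
  thus ?thesis by (rule AE_I') (auto simp: N_def)
qed

lemma AE_torus_measure_nonzero:
  fixes q :: "complex^'n \<Rightarrow> complex"
  assumes q: "complex_polynomial q" "q 0 \<noteq> 0"
  shows "AE \<zeta> in torus_measure. q \<zeta> \<noteq> 0 \<and> (\<forall>i. cmod (\<zeta> $ i) = 1)"
proof -
  let ?M = "restrict_space lborel (cbox 0 (\<chi> i. 2 * pi) :: (real^'n) set)"
  have meas: "(\<lambda>\<theta> :: real^'n. \<chi> i. cis (\<theta> $ i)) \<in> ?M \<rightarrow>\<^sub>M borel"
    by (intro measurable_restrict_space1)
       (simp add: borel_measurable_continuous_onI continuous_on_cis_vec)
  have "open {\<zeta>. q \<zeta> \<noteq> 0}"
    by (intro open_Collect_neq complex_polynomial_continuous q continuous_intros)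
  moreover have "closed {\<zeta> :: complex^'n. \<forall>i. cmod (\<zeta> $ i) = 1}"
    by (intro closed_Collect_all closed_Collect_eq continuous_intros)
  ultimately have "{\<zeta>. q \<zeta> \<noteq> 0} \<inter> {\<zeta>. \<forall>i. cmod (\<zeta> $ i) = 1} \<in> sets borel"
    by (intro sets.Int borel_open borel_closed)
  hence S: "{\<zeta> \<in> space borel. q \<zeta> \<noteq> 0 \<and> (\<forall>i. cmod (\<zeta> $ i) = 1)} \<in> sets borel"
    by (simp add: Collect_conj_eq)
  have "AE \<theta> in ?M. q (\<chi> i. cis (\<theta> $ i)) \<noteq> 0 \<and> (\<forall>i. cmod ((\<chi> i. cis (\<theta> $ i)) $ i) = 1)"
    using AE_polynomial_torus_nonzero[OF q] by (subst AE_restrict_space_iff) auto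
  thus ?thesis unfolding torus_measure_def AE_distr_iff[OF meas S] .
qed

section \<open>Unitary realizations\<close>

text \<open>On the line through \<open>w\<close> in direction \<open>i\<close> only the summand
  \<open>k = i\<close> survives, so the difference quotient is \<open>g $ i * h z $ i\<close>, which
  converges by continuity of \<open>h\<close>.\<close>

lemma partial_deriv_of_difference:
  fixes f :: "complex^'n \<Rightarrow> complex" and h :: "complex^'n \<Rightarrow> complex^'n"
  assumes S: "open S" "w \<in> S" and cont: "continuous_on S (\<lambda>z. h z $ i)"
    and diff: "\<And>z. z \<in> S \<Longrightarrow> f z - f w = (\<Sum>k\<in>UNIV. g $ k * (z $ k - w $ k) * h z $ k)"
  shows "partial_deriv i f w = g $ i * h w $ i"
proof -
  define l where "l t = (\<chi> j. if j = i then t else w $ j)" for t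
  have lw: "l (w $ i) = w" by (simp add: l_def vec_eq_iff)
  have cl: "continuous_on UNIV l"
    unfolding l_def update_eq_line by (rule continuous_on_line)
  have T: "open (l -` S)" using S(1) cl by (rule open_vimage)
  have ev: "\<forall>\<^sub>F t in at (w $ i). t \<in> l -` S - {w $ i}"
    using T S(2) lw by (intro eventually_at_topological[THEN iffD2] exI[of _ "l -` S"]) auto
  have "continuous_on (l -` S) (\<lambda>t. h (l t) $ i)"
    by (intro continuous_on_compose2[OF cont] continuous_on_subset[OF cl]) auto
  hence "((\<lambda>t. h (l t) $ i) \<longlongrightarrow> h w $ i) (at (w $ i))"
    using T S(2) lw by (metis continuous_on_eq_continuous_at isCont_def vimage_eq)
  hence "((\<lambda>t. g $ i * h (l t) $ i) \<longlongrightarrow> g $ i * h w $ i) (at (w $ i))"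
    by (rule tendsto_mult_left)
  moreover have "\<forall>\<^sub>F t in at (w $ i). g $ i * h (l t) $ i = (f (l t) - f (l (w $ i))) / (t - w $ i)"
    using ev
  proof eventually_elim
    case (elim t)
    have "(\<Sum>k\<in>UNIV. g $ k * (l t $ k - w $ k) * h (l t) $ k) =
        (\<Sum>k\<in>UNIV. if k = i then g $ i * (t - w $ i) * h (l t) $ i else 0)"
      by (rule sum.cong) (auto simp: l_def)
    thus ?case using elim diff[of "l t"] by (simp add: lw)
  qed
  ultimately have "((\<lambda>t. (f (l t) - f (l (w $ i))) / (t - w $ i)) \<longlongrightarrow> g $ i * h w $ i) (at (w $ i))"
    by (rule Lim_transform_eventually)
  hence "((\<lambda>t. f (l t)) has_field_derivative g $ i * h w $ i) (at (w $ i))"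
    by (simp add: has_field_derivative_iff)
  thus ?thesis unfolding partial_deriv_def l_def by (rule DERIV_imp_deriv)
qed

definition realization_value :: "complex^1^1 \<Rightarrow> complex^'n^1 \<Rightarrow> complex^'n \<Rightarrow> complex^'n \<Rightarrow> complex"
  where "realization_value A B z h = A $ 1 $ 1 + cdot (B $ 1) (diag_matrix z *v h)"

text \<open>The colligation equation is stated wherever \<open>q\<close> is nonzero, so that it
  covers almost all of the torus as well as the polydisk, where the inverse exists by
  unitarity.\<close>

lemma unitary_realization_rational:
  fixes D :: "complex^'n^'n"
  assumes U: "unitary_matrix (block_matrix A B C D)"
  obtains q p where "complex_polynomial q" "\<And>k. complex_polynomial (p k)" "q 0 \<noteq> 0"
    "\<And>z. z \<in> polydisk \<Longrightarrow> q z \<noteq> 0"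
    "\<And>z. q z \<noteq> 0 \<Longrightarrow> block_matrix A B C D *v colligation_in z (\<chi> k. p k z / q z) =
       colligation_out (realization_value A B z (\<chi> k. p k z / q z)) (\<chi> k. p k z / q z)"
    "\<And>z. z \<in> polydisk \<Longrightarrow>
       (A + B ** diag_matrix z ** matrix_inv (mat 1 - D ** diag_matrix z) ** C) $ 1 $ 1 =
       realization_value A B z (\<chi> k. p k z / q z)"
proof -
  obtain q p where q: "complex_polynomial q" "\<And>k. complex_polynomial (p k)" "q 0 = 1"
    "\<And>z. q z \<noteq> 0 \<longleftrightarrow> invertible (mat 1 - D ** diag_matrix z)"
    and h: "\<And>z h. q z \<noteq> 0 \<Longrightarrow> h = column 1 C + D *v (diag_matrix z *v h) \<longleftrightarrow> h = (\<chi> k. p k z / q z)"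
    by (rule colligation_state_rational[of D "column 1 C"]) (rule that)
  have col: "block_matrix A B C D *v colligation_in z (\<chi> k. p k z / q z) =
       colligation_out (realization_value A B z (\<chi> k. p k z / q z)) (\<chi> k. p k z / q z)"
    if "q z \<noteq> 0" for z
    unfolding colligation_eq_iff realization_value_def using h[OF that] by blast
  have nz: "q z \<noteq> 0" if "z \<in> polydisk" for z
    using q(4) invertible_realization[OF U that] by blast
  have "(A + B ** diag_matrix z ** matrix_inv (mat 1 - D ** diag_matrix z) ** C) $ 1 $ 1 =
       realization_value A B z (\<chi> k. p k z / q z)" if "z \<in> polydisk" for z
    using col[OF nz[OF that]]
    unfolding colligation_iff_realization[OF invertible_realization[OF U that]]
    by (elim conjE) (rule sym)
  with q(1-3) nz col show thesis by (intro that[of q p]) auto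
qed

lemma realization_value_quotient:
  fixes z :: "complex^'n"
  assumes "q z \<noteq> 0"
  shows "realization_value A B z (\<chi> k. p k z / q z) =
    (A $ 1 $ 1 * q z + (\<Sum>k\<in>UNIV. B $ 1 $ k * (z $ k * p k z))) / q z"
  using assms by (simp add: realization_value_def cdot_def sum_divide_distrib add_divide_distrib)

lemma complex_polynomial_realization_numerator:
  assumes "complex_polynomial q" "\<And>k. complex_polynomial (p k)"
  shows "complex_polynomial (\<lambda>z :: complex^'n. A $ 1 $ 1 * q z + (\<Sum>k\<in>UNIV. B $ 1 $ k * (z $ k * p k z)))"
  by (intro complex_polynomial_add complex_polynomial_mult complex_polynomial_sum
      complex_polynomial_const complex_polynomial_nth assms)

lemma rational_line_holomorphic:
  assumes "complex_polynomial p" "complex_polynomial q" "\<And>z. z \<in> S \<Longrightarrow> q z \<noteq> 0"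
  shows "line_holomorphic (\<lambda>z. p z / q z) S"
  unfolding line_holomorphic_def
  by (intro allI holomorphic_on_divide complex_polynomial_line_holomorphic assms) auto

lemma rational_continuous_on:
  assumes "complex_polynomial p" "complex_polynomial q" "\<And>z. z \<in> S \<Longrightarrow> q z \<noteq> 0"
  shows "continuous_on S (\<lambda>z. p z / q z)"
  by (intro continuous_on_divide complex_polynomial_continuous assms ballI)

context
  fixes f :: "complex^'n \<Rightarrow> complex" and A B C and D :: "complex^'n^'n"
  assumes U: "unitary_matrix (block_matrix A B C D)"
    and f: "\<And>z. z \<in> polydisk \<Longrightarrow>
      f z = (A + B ** diag_matrix z ** matrix_inv (mat 1 - D ** diag_matrix z) ** C) $ 1 $ 1"
begin

lemma realization_imp_rational: "rational_on f polydisk"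
proof -
  obtain q p where q: "complex_polynomial q" "\<And>k. complex_polynomial (p k)" "q 0 \<noteq> 0"
    "\<And>z. z \<in> polydisk \<Longrightarrow> q z \<noteq> 0"
    and col: "\<And>z. q z \<noteq> 0 \<Longrightarrow> block_matrix A B C D *v colligation_in z (\<chi> k. p k z / q z) =
       colligation_out (realization_value A B z (\<chi> k. p k z / q z)) (\<chi> k. p k z / q z)"
    and val: "\<And>z. z \<in> polydisk \<Longrightarrow>
       (A + B ** diag_matrix z ** matrix_inv (mat 1 - D ** diag_matrix z) ** C) $ 1 $ 1 =
       realization_value A B z (\<chi> k. p k z / q z)"
    by (rule unitary_realization_rational[OF U]) (rule that)
  have fv: "f z = realization_value A B z (\<chi> k. p k z / q z)" if "z \<in> polydisk" for z
    using f[OF that] val[OF that] by (rule trans)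
  show ?thesis
    unfolding rational_on_def
    by (intro exI[of _ "\<lambda>z. A $ 1 $ 1 * q z + (\<Sum>k\<in>UNIV. B $ 1 $ k * (z $ k * p k z))"] exI[of _ q]
        conjI ballI complex_polynomial_realization_numerator q)
       (simp_all add: fv q realization_value_quotient)
qed

text \<open>At a torus point with \<open>q\<close> nonzero, the rational extension of
  \<open>f\<close> is continuous, so its value is the radial limit. The norm identity at unimodular
  coordinates gives this value modulus 1.\<close>

lemma realization_radial_limit:
  "AE \<zeta> in torus_measure. \<exists>L. ((\<lambda>r::real. f (r *\<^sub>R \<zeta>)) \<longlongrightarrow> L) (at_left 1) \<and> cmod L = 1"
proof -
  obtain q p where q: "complex_polynomial q" "\<And>k. complex_polynomial (p k)" "q 0 \<noteq> 0"
    "\<And>z. z \<in> polydisk \<Longrightarrow> q z \<noteq> 0"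
    and col: "\<And>z. q z \<noteq> 0 \<Longrightarrow> block_matrix A B C D *v colligation_in z (\<chi> k. p k z / q z) =
       colligation_out (realization_value A B z (\<chi> k. p k z / q z)) (\<chi> k. p k z / q z)"
    and val: "\<And>z. z \<in> polydisk \<Longrightarrow>
       (A + B ** diag_matrix z ** matrix_inv (mat 1 - D ** diag_matrix z) ** C) $ 1 $ 1 =
       realization_value A B z (\<chi> k. p k z / q z)"
    by (rule unitary_realization_rational[OF U]) (rule that)
  have fv: "f z = realization_value A B z (\<chi> k. p k z / q z)" if "z \<in> polydisk" for z
    using f[OF that] val[OF that] by (rule trans)
  define P where "P z = A $ 1 $ 1 * q z + (\<Sum>k\<in>UNIV. B $ 1 $ k * (z $ k * p k z))" for z
  have P: "complex_polynomial P"
    unfolding P_def by (intro complex_polynomial_realization_numerator q)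
  show ?thesis
    using AE_torus_measure_nonzero[OF q(1,3)]
  proof eventually_elim
    case (elim \<zeta>)
    have "isCont P \<zeta>" "isCont q \<zeta>"
      using complex_polynomial_continuous[OF P, of UNIV] complex_polynomial_continuous[OF q(1), of UNIV]
      by (auto simp: continuous_on_eq_continuous_at)
    hence "isCont (\<lambda>z. P z / q z) \<zeta>" using elim by (intro continuous_intros) auto
    moreover have "((\<lambda>r::real. r *\<^sub>R \<zeta>) \<longlongrightarrow> 1 *\<^sub>R \<zeta>) (at_left 1)"
      by (intro tendsto_intros)
    ultimately have lim: "((\<lambda>r::real. P (r *\<^sub>R \<zeta>) / q (r *\<^sub>R \<zeta>)) \<longlongrightarrow> P \<zeta> / q \<zeta>) (at_left 1)"
      by (intro isCont_tendsto_compose[of \<zeta> "\<lambda>z. P z / q z"]) simp_all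
    have "\<forall>\<^sub>F r in at_left (1::real). r \<in> {0<..<1}" by (rule eventually_at_leftI[of 0]) auto
    hence "\<forall>\<^sub>F r in at_left (1::real). P (r *\<^sub>R \<zeta>) / q (r *\<^sub>R \<zeta>) = f (r *\<^sub>R \<zeta>)"
    proof eventually_elim
      case (elim r)
      hence "r *\<^sub>R \<zeta> \<in> polydisk"
        using \<open>q \<zeta> \<noteq> 0 \<and> (\<forall>i. cmod (\<zeta> $ i) = 1)\<close> by (simp add: polydisk_def)
      thus ?case by (simp add: fv realization_value_quotient q(4) P_def)
    qed
    with lim have "((\<lambda>r::real. f (r *\<^sub>R \<zeta>)) \<longlongrightarrow> P \<zeta> / q \<zeta>) (at_left 1)"
      by (rule Lim_transform_eventually)
    moreover have "cmod (P \<zeta> / q \<zeta>) = 1"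
    proof -
      have "(cmod (P \<zeta> / q \<zeta>))\<^sup>2 = 1"
        using colligation_norm_identity[OF U col[of \<zeta>]] elim
        by (simp add: realization_value_quotient P_def)
      thus ?thesis by (simp add: power2_eq_1_iff) (smt (verit) norm_ge_zero)
    qed
    ultimately show ?case by blast
  qed
qed

text \<open>Symmetry makes the state of the transposed system equal to the state itself. The
  difference formula then yields squares of state components as partial derivatives, and the norm
  identity becomes the claim.\<close>

lemma symmetric_realization_identity:
  assumes sym: "transpose (block_matrix A B C D) = block_matrix A B C D" and z: "z \<in> polydisk"
  shows "(\<Sum>i\<in>UNIV. (1 - (cmod (z $ i))\<^sup>2) * cmod (partial_deriv i f z)) = 1 - (cmod (f z))\<^sup>2"
proof -
  obtain q p where q: "complex_polynomial q" "\<And>k. complex_polynomial (p k)" "q 0 \<noteq> 0"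
    "\<And>z. z \<in> polydisk \<Longrightarrow> q z \<noteq> 0"
    and col: "\<And>z. q z \<noteq> 0 \<Longrightarrow> block_matrix A B C D *v colligation_in z (\<chi> k. p k z / q z) =
       colligation_out (realization_value A B z (\<chi> k. p k z / q z)) (\<chi> k. p k z / q z)"
    and val: "\<And>z. z \<in> polydisk \<Longrightarrow>
       (A + B ** diag_matrix z ** matrix_inv (mat 1 - D ** diag_matrix z) ** C) $ 1 $ 1 =
       realization_value A B z (\<chi> k. p k z / q z)"
    by (rule unitary_realization_rational[OF U]) (rule that)
  have fv: "f z = realization_value A B z (\<chi> k. p k z / q z)" if "z \<in> polydisk" for z
    using f[OF that] val[OF that] by (rule trans)
  define h where "h z = (\<chi> k. p k z / q z)" for z
  have hf: "block_matrix A B C D *v colligation_in w (h w) = colligation_out (f w) (h w)"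
    if "w \<in> polydisk" for w
    using col[OF q(4)[OF that]] by (simp add: fv that h_def)
  have Dsym: "transpose D = D" and "transpose C = B"
    using sym unfolding transpose_block_matrix block_matrix_eq_iff by auto
  hence BC: "B $ 1 = column 1 C" by (auto simp: vec_eq_iff transpose_def column_def)
  have hz: "h z = B $ 1 + transpose D *v (diag_matrix z *v h z)"
    using hf[OF z] unfolding colligation_eq_iff Dsym BC by blast
  have "partial_deriv i f z = h z $ i * h z $ i" for i
  proof (rule partial_deriv_of_difference[OF open_polydisk z])
    show "continuous_on polydisk (\<lambda>z. h z $ i)"
      using rational_continuous_on[OF q(2) q(1) q(4)] by (simp add: h_def)
    fix w :: "complex^'n" assume w: "w \<in> polydisk"
    show "f w - f z = (\<Sum>k\<in>UNIV. h z $ k * (w $ k - z $ k) * h w $ k)"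
    proof -
      have "f w - f z = - (\<Sum>k\<in>UNIV. h z $ k * (z $ k - w $ k) * h w $ k)"
        using colligation_difference[OF hf[OF w] hf[OF z] hz] by (metis minus_diff_eq)
      also have "\<dots> = (\<Sum>k\<in>UNIV. h z $ k * (w $ k - z $ k) * h w $ k)"
        unfolding sum_negf[symmetric] by (rule sum.cong) (auto simp: algebra_simps)
      finally show ?thesis .
    qed
  qed
  hence "cmod (partial_deriv i f z) = (cmod (h z $ i))\<^sup>2" for i
    by (simp add: norm_mult power2_eq_square)
  thus ?thesis using colligation_norm_identity[OF U hf[OF z]] by simp
qed

end

text \<open>Allows an equality between \<open>f\<close> and the realization to spread from a ball to
  the polydisk.\<close>

lemma unitary_realization_line_holomorphic:
  fixes D :: "complex^'n^'n"
  assumes "unitary_matrix (block_matrix A B C D)"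
  shows "line_holomorphic
    (\<lambda>z. (A + B ** diag_matrix z ** matrix_inv (mat 1 - D ** diag_matrix z) ** C) $ 1 $ 1) polydisk"
    (is "line_holomorphic ?f _")
proof -
  have "rational_on ?f polydisk" by (rule realization_imp_rational[OF assms refl])
  then obtain p q where pq: "complex_polynomial p" "complex_polynomial q"
    "\<And>z. z \<in> polydisk \<Longrightarrow> q z \<noteq> 0 \<and> ?f z = p z / q z"
    unfolding rational_on_def by blast
  have "line_holomorphic (\<lambda>z. p z / q z) polydisk"
    by (rule rational_line_holomorphic) (use pq in auto)
  moreover have "(\<lambda>t. ?f (x + t *s y)) holomorphic_on {t. x + t *s y \<in> polydisk} \<longleftrightarrow>
    (\<lambda>t. p (x + t *s y) / q (x + t *s y)) holomorphic_on {t. x + t *s y \<in> polydisk}" for x y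
    by (rule holomorphic_cong) (use pq(3) in auto)
  ultimately show ?thesis unfolding line_holomorphic_def by simp
qed

section \<open>From the identity to a realization\<close>

lemma line_holomorphic_subset: "line_holomorphic f S \<Longrightarrow> T \<subseteq> S \<Longrightarrow> line_holomorphic f T"
  unfolding line_holomorphic_def by (blast intro: holomorphic_on_subset)

text \<open>Dividing by the value at \<open>z0\<close> gives functions equal to 1 there. On a small
  ball all of them stay in the right half plane, where the principal root is holomorphic; a fixed
  root of \<open>F i z0\<close> restores the factor.\<close>

lemma local_square_roots:
  fixes F :: "'n \<Rightarrow> complex^'n \<Rightarrow> complex"
  assumes W: "open W" "z0 \<in> W" and hol: "\<And>i. line_holomorphic (F i) W"
    and cont: "\<And>i. continuous_on W (F i)" and nz: "\<And>i z. z \<in> W \<Longrightarrow> F i z \<noteq> 0"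
  obtains r h where "r > 0" "ball z0 r \<subseteq> W" "\<And>i. line_holomorphic (\<lambda>z. h z $ i) (ball z0 r)"
    "\<And>i. continuous_on (ball z0 r) (\<lambda>z. h z $ i)" "\<And>i z. z \<in> ball z0 r \<Longrightarrow> h z $ i * h z $ i = F i z"
proof -
  define G where "G i z = F i z / F i z0" for i z
  have G: "continuous_on W (G i)" for i
    unfolding G_def using nz W by (intro continuous_intros cont) auto
  have "open (\<Inter>i. W \<inter> G i -` {c. Re c > 0})"
    by (intro open_INT finite ballI continuous_open_preimage G W open_halfspace_Re_gt)
  moreover have "z0 \<in> (\<Inter>i. W \<inter> G i -` {c. Re c > 0})"
    using W nz by (simp add: G_def)
  ultimately obtain r where r: "r > 0" "ball z0 r \<subseteq> (\<Inter>i. W \<inter> G i -` {c. Re c > 0})"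
    by (metis open_contains_ball)
  have sub: "ball z0 r \<subseteq> W" using r(2) by auto
  have np: "G i z \<notin> \<real>\<^sub>\<le>\<^sub>0" if "z \<in> ball z0 r" for i z
  proof -
    have "Re (G i z) > 0" using subsetD[OF r(2) that] by simp
    thus ?thesis by (simp add: complex_nonpos_Reals_iff)
  qed
  define h where "h z = (\<chi> i. csqrt (F i z0) * csqrt (G i z))" for z
  show thesis
  proof (rule that[OF r(1) sub])
    fix i
    show "line_holomorphic (\<lambda>z. h z $ i) (ball z0 r)"
      unfolding line_holomorphic_def h_def vec_lambda_beta
    proof (intro allI holomorphic_intros)
      fix x y
      show "(\<lambda>t. G i (x + t *s y)) holomorphic_on {t. x + t *s y \<in> ball z0 r}"
        unfolding G_def using line_holomorphic_subset[OF hol sub, of i] nz W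
        by (intro holomorphic_intros) (auto simp: line_holomorphic_def)
    qed (use np in auto)
    show "continuous_on (ball z0 r) (\<lambda>z. h z $ i)"
      unfolding h_def vec_lambda_beta
      by (intro continuous_intros continuous_on_compose2[OF continuous_on_csqrt continuous_on_subset[OF G sub]])
         (use np in auto)
    show "h z $ i * h z $ i = F i z" for z
    proof -
      have "h z $ i * h z $ i = (csqrt (F i z0))\<^sup>2 * (csqrt (G i z))\<^sup>2"
        by (simp add: h_def power2_eq_square)
      thus ?thesis using nz W by (simp add: G_def)
    qed
  qed
qed

text \<open>The difference of the two sides is holomorphic in \<open>z\<close>, antiholomorphic in
  \<open>w\<close>, and zero on the diagonal by hypothesis; polarization makes it vanish everywhere.
  The result is an Agler decomposition of \<open>f\<close> on \<open>S\<close>.\<close>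

lemma identity_imp_kernel_decomposition:
  fixes f :: "complex^'n \<Rightarrow> complex" and h :: "complex^'n \<Rightarrow> complex^'n"
  assumes S: "open S" "convex S" and f: "line_holomorphic f S"
    and h: "\<And>i. line_holomorphic (\<lambda>z. h z $ i) S"
    and id: "\<And>z. z \<in> S \<Longrightarrow>
      (\<Sum>i\<in>UNIV. (1 - (cmod (z $ i))\<^sup>2) * (cmod (h z $ i))\<^sup>2) = 1 - (cmod (f z))\<^sup>2"
    and zw: "z \<in> S" "w \<in> S"
  shows "1 - f z * cnj (f w) = (\<Sum>i\<in>UNIV. (1 - z $ i * cnj (w $ i)) * (h z $ i * cnj (h w $ i)))"
proof -
  define \<Phi> where "\<Phi> z w = 1 - f z * cnj (f w) -
      (\<Sum>i\<in>UNIV. (1 - z $ i * cnj (w $ i)) * (h z $ i * cnj (h w $ i)))" for z w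
  have "\<Phi> z w = 0"
  proof (rule polarization[OF S _ _ zw])
    fix m e
    let ?T = "{t. m + t *s e \<in> S \<and> m + cnj t *s e \<in> S}"
    have 1: "(\<lambda>t. g (m + t *s e)) holomorphic_on ?T" if "line_holomorphic g S" for g
      using that unfolding line_holomorphic_def by (blast intro: holomorphic_on_subset)
    have 2: "(\<lambda>t. cnj (g (m + cnj t *s e))) holomorphic_on ?T" if "line_holomorphic g S" for g
      by (rule holomorphic_on_subset[OF line_holomorphic_cnj_line[OF that S(1)]]) auto
    have 3: "(\<lambda>t. (m + t *s e) $ i) holomorphic_on ?T" for i
      by (simp, intro holomorphic_intros)
    have 4: "(\<lambda>t. cnj ((m + cnj t *s e) $ i)) holomorphic_on ?T" for i
      by (simp, intro holomorphic_intros)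
    show "(\<lambda>t. \<Phi> (m + t *s e) (m + cnj t *s e)) holomorphic_on ?T"
      unfolding \<Phi>_def by (intro holomorphic_on_diff holomorphic_on_mult holomorphic_on_sum
          holomorphic_on_const 1 2 3 4 f h)
  next
    fix z assume "z \<in> S"
    have "\<Phi> z z = complex_of_real (1 - (cmod (f z))\<^sup>2 -
        (\<Sum>i\<in>UNIV. (1 - (cmod (z $ i))\<^sup>2) * (cmod (h z $ i))\<^sup>2))"
      by (simp add: \<Phi>_def complex_norm_square del: of_real_power)
    thus "\<Phi> z z = 0" using id[OF \<open>z \<in> S\<close>] by simp
  qed
  thus ?thesis by (simp add: \<Phi>_def)
qed

text \<open>A contractive interpolant gives the difference formula with an unknown vector
  \<open>g\<close> attached to \<open>w\<close>. Differentiating it at \<open>w\<close> yields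
  \<open>g $ i * h w $ i\<close>, which must be the square of \<open>h w $ i\<close>; cancelling the
  nonzero factor identifies \<open>g\<close> with \<open>h w\<close>.\<close>

lemma kernel_decomposition_imp_difference_formula:
  fixes f :: "complex^'n \<Rightarrow> complex" and h :: "complex^'n \<Rightarrow> complex^'n"
  assumes S: "open S" "S \<subseteq> polydisk" and cont: "\<And>i. continuous_on S (\<lambda>z. h z $ i)"
    and deriv: "\<And>i z. z \<in> S \<Longrightarrow> partial_deriv i f z = h z $ i * h z $ i"
    and nz: "\<And>i z. z \<in> S \<Longrightarrow> h z $ i \<noteq> 0"
    and herm: "\<And>z w. z \<in> S \<Longrightarrow> w \<in> S \<Longrightarrow>
      cdot (colligation_in z (h z)) (conj_vec (colligation_in w (h w))) =
      cdot (colligation_out (f z) (h z)) (conj_vec (colligation_out (f w) (h w)))"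
    and zw: "z \<in> S" "w \<in> S"
  shows "f w - f z = (\<Sum>i\<in>UNIV. h w $ i * (w $ i - z $ i) * h z $ i)"
proof -
  obtain T where T: "\<And>x. norm (transpose T *v x) \<le> norm x"
    and Tin: "\<And>z. z \<in> S \<Longrightarrow> T *v colligation_in z (h z) = colligation_out (f z) (h z)"
    using contractive_interpolation[of S "\<lambda>z. colligation_in z (h z)" "\<lambda>z. colligation_out (f z) (h z)"]
      herm by metis
  obtain A B C D where ABCD: "T = block_matrix A B C D" by (rule block_matrix_cases)
  \<comment> \<open>The equation for \<open>g\<close> involves \<open>transpose D\<close>, and its
    solvability at \<open>w\<close> rests on the contractivity of
    \<open>transpose T\<close>.\<close>
  have D: "norm (transpose D *v y) \<le> norm y" for y
    by (rule block_matrix_contraction[OF T[unfolded ABCD transpose_block_matrix]])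
  define g where "g = matrix_inv (mat 1 - transpose D ** diag_matrix w) *v (B $ 1)"
  have "w \<in> polydisk" using zw S by auto
  hence g: "g = B $ 1 + transpose D *v (diag_matrix w *v g)"
    using colligation_state[OF invertible_contraction[OF D]] g_def by blast
  have diff: "f w - f z = (\<Sum>i\<in>UNIV. g $ i * (w $ i - z $ i) * h z $ i)" if "z \<in> S" for z
    by (rule colligation_difference[OF Tin[OF that, unfolded ABCD] Tin[OF zw(2), unfolded ABCD] g])
  have "g $ i = h w $ i" for i
  proof -
    have "partial_deriv i f w = g $ i * h w $ i"
    proof (rule partial_deriv_of_difference[OF S(1) zw(2) cont])
      fix z assume "z \<in> S"
      have "f z - f w = - (\<Sum>i\<in>UNIV. g $ i * (w $ i - z $ i) * h z $ i)"
        using diff[OF \<open>z \<in> S\<close>] by (metis minus_diff_eq)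
      also have "\<dots> = (\<Sum>i\<in>UNIV. g $ i * (z $ i - w $ i) * h z $ i)"
        unfolding sum_negf[symmetric] by (rule sum.cong) (auto simp: algebra_simps)
      finally show "f z - f w = (\<Sum>i\<in>UNIV. g $ i * (z $ i - w $ i) * h z $ i)" .
    qed
    thus ?thesis using deriv[OF zw(2), of i] nz[OF zw(2), of i] by simp
  qed
  thus ?thesis using diff[OF zw(1)] by simp
qed

lemma identity_imp_symmetric_realization:
  fixes f :: "complex^'n \<Rightarrow> complex"
  assumes hol: "f holomorphic_vec_on polydisk" and bd: "f ` polydisk \<subseteq> ball 0 1"
    and dep: "\<And>i. \<exists>z\<in>polydisk. partial_deriv i f z \<noteq> 0"
    and id: "\<And>z. z \<in> polydisk \<Longrightarrow>
      (\<Sum>i\<in>UNIV. (1 - (cmod (z $ i))\<^sup>2) * cmod (partial_deriv i f z)) = 1 - (cmod (f z))\<^sup>2"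
  obtains A B C D where "unitary_matrix (block_matrix A B C D)"
    "transpose (block_matrix A B C D) = block_matrix A B C D"
    "\<And>z. z \<in> polydisk \<Longrightarrow>
      f z = (A + B ** diag_matrix z ** matrix_inv (mat 1 - D ** diag_matrix z) ** C) $ 1 $ 1"
proof -
  note pd = partial_deriv_line_holomorphic[OF hol bd] partial_deriv_continuous_on[OF hol bd]
  have "(0::complex^'n) \<in> polydisk" by (simp add: polydisk_def)
  hence ne: "(polydisk :: (complex^'n) set) \<noteq> {}" by blast
  \<comment> \<open>All partial derivatives are nonzero on a common open set, which permits both the
    square roots and the cancellation in the difference formula.\<close>
  have "\<exists>W. open W \<and> W \<noteq> {} \<and> W \<subseteq> polydisk \<and> (\<forall>i\<in>UNIV. \<forall>z\<in>W. partial_deriv i f z \<noteq> 0)"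
    by (rule common_nonzero_open[OF open_polydisk convex_polydisk ne finite pd dep])
  then obtain W z0 where W: "open W" "z0 \<in> W" "W \<subseteq> polydisk"
    "\<And>i z. z \<in> W \<Longrightarrow> partial_deriv i f z \<noteq> 0" by blast
  obtain r h where r: "r > 0" "ball z0 r \<subseteq> W"
    and h: "\<And>i. line_holomorphic (\<lambda>z. h z $ i) (ball z0 r)"
      "\<And>i. continuous_on (ball z0 r) (\<lambda>z. h z $ i)"
      "\<And>i z. z \<in> ball z0 r \<Longrightarrow> h z $ i * h z $ i = partial_deriv i f z"
    by (rule local_square_roots[of W z0 "\<lambda>i. partial_deriv i f", OF W(1,2)
          line_holomorphic_subset[OF pd(1) W(3)] continuous_on_subset[OF pd(2) W(3)] W(4)])
       (assumption, rule that)
  let ?S = "ball z0 r"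
  have sub: "?S \<subseteq> polydisk" using r(2) W(3) by blast
  note fl = holomorphic_vec_on_imp_line_holomorphic[OF hol open_polydisk]
  have kernel: "1 - f z * cnj (f w) = (\<Sum>i\<in>UNIV. (1 - z $ i * cnj (w $ i)) * (h z $ i * cnj (h w $ i)))"
    if "z \<in> ?S" "w \<in> ?S" for z w
  proof (rule identity_imp_kernel_decomposition[OF open_ball convex_ball
        line_holomorphic_subset[OF fl sub] h(1) _ that])
    fix z assume z: "z \<in> ?S"
    have "(cmod (h z $ i))\<^sup>2 = cmod (partial_deriv i f z)" for i
      using h(3)[OF z, of i] by (metis norm_mult power2_eq_square)
    thus "(\<Sum>i\<in>UNIV. (1 - (cmod (z $ i))\<^sup>2) * (cmod (h z $ i))\<^sup>2) = 1 - (cmod (f z))\<^sup>2"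
      using id[of z] z sub by auto
  qed
  have herm: "cdot (colligation_in z (h z)) (conj_vec (colligation_in w (h w))) =
      cdot (colligation_out (f z) (h z)) (conj_vec (colligation_out (f w) (h w)))"
    if "z \<in> ?S" "w \<in> ?S" for z w
    using kernel[OF that] unfolding cdot_colligation_in cdot_colligation_out
    by (simp add: left_diff_distrib sum_subtractf diff_eq_eq) (simp add: algebra_simps)
  have diff: "f w - f z = (\<Sum>i\<in>UNIV. h w $ i * (w $ i - z $ i) * h z $ i)"
    if "z \<in> ?S" "w \<in> ?S" for z w
  proof (rule kernel_decomposition_imp_difference_formula[OF open_ball sub h(2) _ _ herm that])
    show "partial_deriv i f z = h z $ i * h z $ i" if "z \<in> ?S" for i z
      using h(3)[OF that] by simp
    show "h z $ i \<noteq> 0" if "z \<in> ?S" for i z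
      using h(3)[OF that, of i] W(4)[of z i] r(2) that by auto
  qed
  \<comment> \<open>The difference formula, with the terms in \<open>z\<close> and in
    \<open>w\<close> collected on opposite sides, is the symmetry condition for the
    interpolation.\<close>
  have sym: "cdot (colligation_in z (h z)) (colligation_out (f w) (h w)) =
      cdot (colligation_in w (h w)) (colligation_out (f z) (h z))"
    if "z \<in> ?S" "w \<in> ?S" for z w
  proof -
    have "f w - f z = (\<Sum>i\<in>UNIV. w $ i * h w $ i * h z $ i) - (\<Sum>i\<in>UNIV. z $ i * h z $ i * h w $ i)"
      unfolding diff[OF that] sum_subtractf[symmetric]
      by (rule sum.cong) (auto simp: algebra_simps)
    thus ?thesis unfolding cdot_colligation_in_out by (simp add: algebra_simps)
  qed
  obtain U where U: "unitary_matrix U" "transpose U = U"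
    and Uin: "\<And>z. z \<in> ?S \<Longrightarrow> U *v colligation_in z (h z) = colligation_out (f z) (h z)"
    by (rule symmetric_unitary_interpolation[of ?S "\<lambda>z. colligation_in z (h z)"
          "\<lambda>z. colligation_out (f z) (h z)", OF herm sym]) (assumption+, rule that)
  obtain A B C D where ABCD: "U = block_matrix A B C D" by (rule block_matrix_cases)
  note U' = U[unfolded ABCD]
  have loc: "f z = (A + B ** diag_matrix z ** matrix_inv (mat 1 - D ** diag_matrix z) ** C) $ 1 $ 1"
    if "z \<in> ?S" for z
  proof -
    have "z \<in> polydisk" using that sub by blast
    from Uin[OF that, unfolded ABCD colligation_iff_realization[OF invertible_realization[OF U'(1) this]]]
    show ?thesis by (rule conjunct1)
  qed
  \<comment> \<open>The local realization extends by the identity theorem, both sides being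
    holomorphic along lines in the whole polydisk.\<close>
  have "f z = (A + B ** diag_matrix z ** matrix_inv (mat 1 - D ** diag_matrix z) ** C) $ 1 $ 1"
    if "z \<in> polydisk" for z
    by (rule line_holomorphic_identity[OF fl unitary_realization_line_holomorphic[OF U'(1)]
          open_polydisk convex_polydisk open_ball sub _ loc that, of z0]) (use r in auto)
  with U' show thesis by (rule that)
qed

theorem theorem1p3:
  fixes f :: "complex^'n \<Rightarrow> complex"
  assumes "f holomorphic_vec_on polydisk"
    and "f ` polydisk \<subseteq> ball 0 1"
    and "\<forall>i. \<exists>z\<in>polydisk. partial_deriv i f z \<noteq> 0"
  shows
    "((\<forall>z\<in>polydisk.
         (\<Sum>i\<in>UNIV. (1 - (cmod (z $ i))\<^sup>2) * cmod (partial_deriv i f z)) = 1 - (cmod (f z))\<^sup>2)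
      \<longleftrightarrow>
      (\<exists>U A B C D. U = block_matrix A B C D \<and> unitary_matrix U \<and> U = transpose U \<and>
         (\<forall>z\<in>polydisk.
            f z = (A + B ** diag_matrix z
                       ** matrix_inv (mat 1 - D ** diag_matrix z) ** C) $ 1 $ 1)))
     \<and>
     ((\<forall>z\<in>polydisk.
         (\<Sum>i\<in>UNIV. (1 - (cmod (z $ i))\<^sup>2) * cmod (partial_deriv i f z)) = 1 - (cmod (f z))\<^sup>2)
      \<longrightarrow> rational_on f polydisk \<and> inner_function f)"
    (is "(?id \<longleftrightarrow> ?real) \<and> (?id \<longrightarrow> ?rat)")
proof -
  \<comment> \<open>Rationality and innerness are read off from the realization, so they are
    obtained together with it.\<close>
  have fwd: "?real \<and> ?rat" if id: ?id
  proof -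
    obtain A B C D where U: "unitary_matrix (block_matrix A B C D)"
      "transpose (block_matrix A B C D) = block_matrix A B C D"
      and f: "\<And>z. z \<in> polydisk \<Longrightarrow>
        f z = (A + B ** diag_matrix z ** matrix_inv (mat 1 - D ** diag_matrix z) ** C) $ 1 $ 1"
      by (rule identity_imp_symmetric_realization[OF assms(1,2) assms(3)[rule_format] id[rule_format]])
         (assumption, rule that)
    have ?real
      by (rule exI[of _ "block_matrix A B C D"], rule exI[of _ A], rule exI[of _ B],
          rule exI[of _ C], rule exI[of _ D])
         (intro conjI refl U(1) U(2)[symmetric] ballI f)
    moreover have "inner_function f"
      unfolding inner_function_def
      using assms(1) bounded_subset[OF bounded_ball assms(2)] realization_radial_limit[OF U(1) f] by blast
    ultimately show ?thesis using realization_imp_rational[OF U(1) f] by blast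
  qed
  have "?id" if ?real
  proof -
    from that obtain U A B C D where U: "U = block_matrix A B C D" "unitary_matrix U" "U = transpose U"
      and f: "\<forall>z\<in>polydisk. f z = (A + B ** diag_matrix z
                       ** matrix_inv (mat 1 - D ** diag_matrix z) ** C) $ 1 $ 1"
      by (elim exE conjE) (rule that)
    show ?thesis
      using symmetric_realization_identity[OF U(2)[unfolded U(1)] f[rule_format] U(3)[symmetric, unfolded U(1)]]
      by (rule ballI)
  qed
  with fwd show ?thesis by blast
qed

end
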